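(* Let $K$ be a field of characteristic $0$, let $A$ be a dg-algebra over $K$ and let $H(A)$ be its cohomology algebra. Suppose that the product on $H(A)$ induced by the product of $A$ is trivial (i.e. $xy=0$ for all $x,y\in H(A)$), and that all Massey $n$-products on $A$ with $n\geq 3$ vanish, i.e. for every $n\ge 3$ and all homogeneous classes $x_1,\ldots,x_n\in H(A)$ for which $\langle x_1,\ldots,x_n\rangle$ is defined, one has $0\in\langle x_1,\ldots,x_n\rangle$. Then $A$ is formal.
   Context: Throughout, $K$ is a field of characteristic $0$. An $A_\infty$-algebra $(A,m)$ over $K$ is a $\mathbb{Z}$-graded $K$-vector space $A=\bigoplus_{i\in\mathbb{Z}}A_i$ with $K$-linear maps $m_n:A^{\otimes n}\to A$ of degree $2-n$ ($n\ge 1$) such that for all $n\geq 1$ $$\sum_{r+s+t=n}(-1)^{r+st}\,m_{r+1+t}(\mathrm{Id}^{\otimes r}\otimes m_s\otimes \mathrm{Id}^{\otimes t})=0,$$ where $s\ge 1$ and $r,t\ge 0$ (Koszul sign rule when applied to elements). A dg-algebra is an $A_\infty$-algebra with $m_i=0$ for $i\ge 3$; equivalently, a $\mathbb{Z}$-graded $K$-vector space with an associative product $m_2$ and a differential $d=m_1$ of degree $+1$ satisfying the graded Leibniz rule (no unit is required). Its cohomology algebra $H(A)$ is the cohomology of $d$ with the induced product, regarded as a dg-algebra with zero differential. A morphism of $A_\infty$-algebras $f:(A,m^A)\to(B,m^B)$ is a family of linear maps $f_n:A^{\otimes n}\to B$ of degree $1-n$ ($n\ge1$) such that for all $n\ge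 1$ $$\sum_{r+s+t=n}(-1)^{r+st}f_{r+1+t}(\mathrm{Id}^{\otimes r}\otimes m^A_s\otimes \mathrm{Id}^{\otimes t})=\sum_{k=1}^{n}\ \sum_{i_1+\cdots+i_k=n}(-1)^{u_k}m^B_k(f_{i_1}\otimes\cdots\otimes f_{i_k}),$$ where $u_k=\sum_{t=1}^{k-1}t(i_{k-t}-1)$. It is an $A_\infty$-quasi-isomorphism if $f_1$ induces an isomorphism on cohomology with respect to $m_1^A$ and $m_1^B$. A dg-algebra $A$ is formal if it is $A_\infty$-quasi-isomorphic to a dg-algebra with zero differential; equivalently, if it is $A_\infty$-quasi-isomorphic to the dg-algebra $H(A)$; equivalently, if it is connected to $H(A)$ by a zig-zag of quasi-isomorphisms of dg-algebras. Massey products: for a homogeneous element $x$ write $\bar{x}=(-1)^{|x|}x$, where $|x|$ is the degree of $x$. A defining system for homogeneous classes $x_1,\ldots,x_n\in H(A)$ is a collection $\{a_{i,j}\}$ of (homogeneous) cochains in $A$, indexed by pairs $0\le i<j\le n$ with $(i,j)\ne(0,n)$, such that $[a_{i-1,i}]=x_i$ for $1\le i\le n$ and $d(a_{i,j})=\sum_{i<k<j}\overline{a_{i,k}}\,a_{k,j}$ for all these pairs. The Massey $n$-product $\langle x_1,\ldots,x_n\rangle$ is the set of all classes $[a_{0,n}]$ with $a_{0,n}=\sum_{0<k<n}\overline{a_{0,k}}\,a_{k,n}$, as $\{a_{i,j}\}$ ranges over all defining systems. It is defined if at least one defining system exists, and it vanishes if it contains $0$. *)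

theory Defs
  imports Complex_Main
begin

section \<open>Graded vector spaces\<close>

text \<open>
  A graded vector space is given internally: the homogeneous parts are subspaces of the vector
  space formed by the type 'a under \<open>scl\<close>, and the graded space itself is the
  (direct) sum of these parts, which need not be all of 'a.  The component \<open>mlt n\<close> is the
  operation of arity n; it is applied to lists of length n, and its values on other lists or on
  elements outside the graded space are irrelevant.
\<close>

record ('k, 'a) ainf =
  scl :: "'k \<Rightarrow> 'a \<Rightarrow> 'a"
  part :: "int \<Rightarrow> 'a set"
  mlt :: "nat \<Rightarrow> 'a list \<Rightarrow> 'a"

definition graded_space :: "('k::field, 'a::ab_group_add, 'm) ainf_scheme \<Rightarrow> bool" where
  "graded_space A \<longleftrightarrow>
     vector_space (scl A) \<and>
     (\<forall>p. module.subspace (scl A) (part A p)) \<and>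
     (\<forall>I x. finite I \<and> (\<forall>p\<in>I. x p \<in> part A p) \<and> (\<Sum>p\<in>I. x p) = 0 \<longrightarrow> (\<forall>p\<in>I. x p = 0))"

definition total_space :: "('k::field, 'a::ab_group_add, 'm) ainf_scheme \<Rightarrow> 'a set" where
  "total_space A = module.span (scl A) (\<Union>p. part A p)"

text \<open>\<open>homog A ds xs\<close>: the entries of xs are homogeneous of the degrees listed in ds.\<close>

definition homog :: "('k::field, 'a::ab_group_add, 'm) ainf_scheme \<Rightarrow> int list \<Rightarrow> 'a list \<Rightarrow> bool" where
  "homog A ds xs \<longleftrightarrow> list_all2 (\<lambda>p x. x \<in> part A p) ds xs"

text \<open>
  A linear map of degree p from the n-th tensor power of A to B, as an n-linear map on the
  graded space A.
\<close>

definition multilinear_deg ::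
  "('k::field, 'a::ab_group_add, 'm) ainf_scheme \<Rightarrow> ('k, 'b::ab_group_add, 'l) ainf_scheme
     \<Rightarrow> nat \<Rightarrow> int \<Rightarrow> ('a list \<Rightarrow> 'b) \<Rightarrow> bool" where
  "multilinear_deg A B n p g \<longleftrightarrow>
     (\<forall>xs i x y. length xs = n \<and> set xs \<subseteq> total_space A \<and> i < n \<and>
          x \<in> total_space A \<and> y \<in> total_space A
        \<longrightarrow> g (xs[i := x + y]) = g (xs[i := x]) + g (xs[i := y])) \<and>
     (\<forall>xs i c x. length xs = n \<and> set xs \<subseteq> total_space A \<and> i < n \<and> x \<in> total_space A
        \<longrightarrow> g (xs[i := scl A c x]) = scl B c (g (xs[i := x]))) \<and>
     (\<forall>ds xs. length xs = n \<and> homog A ds xs \<longrightarrow> g xs \<in> part B (sum_list ds + p))"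


section \<open>A-infinity algebras and their morphisms\<close>

text \<open>
  \<open>insert_sum A B g ds xs\<close> is the sum over all r + s + t = n, with s at least 1, of
  \<open>(-1) ^ (r + s t)\<close> times g of arity r + 1 + t after
  \<open>Id\<^sup>\<otimes>\<^sup>r \<otimes> m_s \<otimes> Id\<^sup>\<otimes>\<^sup>t\<close>, evaluated on homogeneous arguments xs of degrees ds.  The Koszul
  sign comes from moving the operation of degree 2 - s past the first r arguments.
\<close>

definition insert_sum ::
  "('k::field, 'a::ab_group_add, 'm) ainf_scheme \<Rightarrow> ('k, 'b::ab_group_add, 'l) ainf_scheme
     \<Rightarrow> (nat \<Rightarrow> 'a list \<Rightarrow> 'b) \<Rightarrow> int list \<Rightarrow> 'a list \<Rightarrow> 'b" where
  "insert_sum A B g ds xs =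
     (\<Sum>(r, s, t) \<in> {(r, s, t). r + s + t = length xs \<and> 1 \<le> s}.
        scl B ((-1) ^ (r + s * t) * (-1) powi ((2 - int s) * sum_list (take r ds)))
          (g (r + 1 + t)
             (take r xs @ [mlt A s (take s (drop r xs))] @ drop (r + s) xs)))"

lemma finite_insert_index: "finite {(r, s, t). r + s + t = (n::nat) \<and> 1 \<le> s}"
proof (rule finite_subset)
  show "{(r, s, t). r + s + t = n \<and> 1 \<le> s} \<subseteq> {..n} \<times> {..n} \<times> {..n}" by auto
qed simp

definition A_inf_algebra :: "('k::field, 'a::ab_group_add, 'm) ainf_scheme \<Rightarrow> bool" where
  "A_inf_algebra A \<longleftrightarrow>
     graded_space A \<and>
     (\<forall>n\<ge>1. multilinear_deg A A n (2 - int n) (mlt A n)) \<and>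
     (\<forall>ds xs. 1 \<le> length xs \<and> homog A ds xs \<longrightarrow> insert_sum A A (mlt A) ds xs = 0)"

text \<open>
  For a composition is = [i_1, ..., i_k] of n, \<open>block is xs j\<close> is the part of xs that is fed
  into the factor with (0-based) index j of \<open>f_{i_1} \<otimes> \<dots> \<otimes> f_{i_k}\<close>.  Since this factor has
  degree 1 - i_j, \<open>koszul_exp is ds\<close> is the exponent of the Koszul sign produced by evaluating
  the tensor product on arguments of degrees ds, and \<open>u_exp is\<close> is the sum of
  t (i_{k-t} - 1) over t = 1, ..., k - 1 (the list index is shifted by one).
\<close>

definition block :: "nat list \<Rightarrow> 'a list \<Rightarrow> nat \<Rightarrow> 'a list" where
  "block is xs j = take (is ! j) (drop (sum_list (take j is)) xs)"

definition koszul_exp :: "nat list \<Rightarrow> int list \<Rightarrow> int" where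
  "koszul_exp is ds =
     (\<Sum>j<length is. (1 - int (is ! j)) * sum_list (take (sum_list (take j is)) ds))"

definition u_exp :: "nat list \<Rightarrow> int" where
  "u_exp is = (\<Sum>t\<in>{1..<length is}. int t * (int (is ! (length is - t - 1)) - 1))"

definition compositions :: "nat \<Rightarrow> nat \<Rightarrow> nat list set" where
  "compositions k n = {is. length is = k \<and> (\<forall>i\<in>set is. 1 \<le> i) \<and> sum_list is = n}"

lemma finite_compositions: "finite (compositions k n)"
proof (rule finite_subset)
  show "compositions k n \<subseteq> {is. set is \<subseteq> {..n} \<and> length is = k}"
    by (auto simp: compositions_def member_le_sum_list)
qed (simp add: finite_lists_length_eq)

definition A_inf_morphism ::
  "('k::field, 'a::ab_group_add, 'm) ainf_scheme \<Rightarrow> ('k, 'b::ab_group_add, 'l) ainf_scheme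
     \<Rightarrow> (nat \<Rightarrow> 'a list \<Rightarrow> 'b) \<Rightarrow> bool" where
  "A_inf_morphism A B f \<longleftrightarrow>
     (\<forall>n\<ge>1. multilinear_deg A B n (1 - int n) (f n)) \<and>
     (\<forall>ds xs. 1 \<le> length xs \<and> homog A ds xs \<longrightarrow>
        insert_sum A B f ds xs =
        (\<Sum>k = 1..length xs. \<Sum>is\<in>compositions k (length xs).
           scl B ((-1) powi (u_exp is) * (-1) powi (koszul_exp is ds))
             (mlt B k (map (\<lambda>j. f (is ! j) (block is xs j)) [0..<k]))))"


section \<open>Cohomology and formality\<close>

definition diff :: "('k, 'a, 'm) ainf_scheme \<Rightarrow> 'a \<Rightarrow> 'a" where
  "diff A x = mlt A 1 [x]"

definition prd :: "('k, 'a, 'm) ainf_scheme \<Rightarrow> 'a \<Rightarrow> 'a \<Rightarrow> 'a" where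
  "prd A x y = mlt A 2 [x, y]"

definition cocycles :: "('k::field, 'a::ab_group_add, 'm) ainf_scheme \<Rightarrow> 'a set" where
  "cocycles A = {x \<in> total_space A. diff A x = 0}"

definition coh_class :: "('k::field, 'a::ab_group_add, 'm) ainf_scheme \<Rightarrow> 'a \<Rightarrow> 'a set" where
  "coh_class A z = {z + diff A y |y. y \<in> total_space A}"

definition cohomology :: "('k::field, 'a::ab_group_add, 'm) ainf_scheme \<Rightarrow> 'a set set" where
  "cohomology A = coh_class A ` cocycles A"

definition cohomology_deg ::
  "('k::field, 'a::ab_group_add, 'm) ainf_scheme \<Rightarrow> int \<Rightarrow> 'a set set" where
  "cohomology_deg A p = coh_class A ` (cocycles A \<inter> part A p)"

text \<open>
  The induced product of two classes, and the map induced on classes by a chain map g: the union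
  over representatives of the resulting class, which does not depend on the representatives.
\<close>

definition coh_prd ::
  "('k::field, 'a::ab_group_add, 'm) ainf_scheme \<Rightarrow> 'a set \<Rightarrow> 'a set \<Rightarrow> 'a set" where
  "coh_prd A X Y = (\<Union>x\<in>X. \<Union>y\<in>Y. coh_class A (prd A x y))"

definition coh_map ::
  "('k::field, 'b::ab_group_add, 'm) ainf_scheme \<Rightarrow> ('a \<Rightarrow> 'b) \<Rightarrow> 'a set \<Rightarrow> 'b set" where
  "coh_map B g X = (\<Union>x\<in>X. coh_class B (g x))"

text \<open>The map induced by f_1 is linear of degree 0, so it is an isomorphism iff it is bijective.\<close>

definition A_inf_quasi_isomorphism ::
  "('k::field, 'a::ab_group_add, 'm) ainf_scheme \<Rightarrow> ('k, 'b::ab_group_add, 'l) ainf_scheme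
     \<Rightarrow> (nat \<Rightarrow> 'a list \<Rightarrow> 'b) \<Rightarrow> bool" where
  "A_inf_quasi_isomorphism A B f \<longleftrightarrow>
     A_inf_morphism A B f \<and>
     bij_betw (coh_map B (\<lambda>x. f 1 [x])) (cohomology A) (cohomology B)"

definition dg_algebra :: "('k::field, 'a::ab_group_add, 'm) ainf_scheme \<Rightarrow> bool" where
  "dg_algebra A \<longleftrightarrow>
     A_inf_algebra A \<and>
     (\<forall>n\<ge>3. \<forall>xs. length xs = n \<and> set xs \<subseteq> total_space A \<longrightarrow> mlt A n xs = 0)"

text \<open>
  The dg-algebra B with zero differential is sought on the same type as A.  This loses nothing:
  any such B is isomorphic to the cohomology of A as a graded vector space, hence to a graded
  complement of the coboundaries of A in the cocycles.
\<close>

definition formal :: "('k::field, 'a::ab_group_add) ainf \<Rightarrow> bool" where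
  "formal A \<longleftrightarrow>
     (\<exists>B :: ('k, 'a) ainf. dg_algebra B \<and> (\<forall>x\<in>total_space B. diff B x = 0) \<and>
        (\<exists>f. A_inf_quasi_isomorphism A B f))"


subsection \<open>The usual description of dg-algebras\<close>

lemma insert_sum_1:
  assumes "graded_space A"
  shows "insert_sum A A (mlt A) [p] [x] = diff A (diff A x)"
proof -
  interpret vector_space "scl A" using assms by (simp add: graded_space_def)
  have eq: "{(r, s, t). r + s + t = length [x] \<and> 1 \<le> s} = {(0, 1, 0)}"
    by auto
  show ?thesis
    unfolding insert_sum_def eq by (simp add: diff_def)
qed

lemma insert_sum_2:
  assumes "graded_space A"
  shows "insert_sum A A (mlt A) [p, q] [x, y] =
    diff A (prd A x y) - prd A (diff A x) y - scl A ((-1) powi p) (prd A x (diff A y))"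
proof -
  interpret vector_space "scl A" using assms by (simp add: graded_space_def)
  have eq: "{(r, s, t). r + s + t = length [x, y] \<and> 1 \<le> s} = {(0, 2, 0), (0, 1, 1), (1, 1, 0)}"
    by auto
  show ?thesis
    unfolding insert_sum_def eq
    by (simp add: diff_def prd_def numeral_2_eq_2)
qed

lemma insert_sum_3:
  assumes "graded_space A" and "diff A 0 = 0" "mlt A 3 [x, y, z] = 0"
    and "mlt A 3 [diff A x, y, z] = 0" "mlt A 3 [x, diff A y, z] = 0" "mlt A 3 [x, y, diff A z] = 0"
  shows "insert_sum A A (mlt A) [p, q, r] [x, y, z] =
    prd A (prd A x y) z - prd A x (prd A y z)"
proof -
  interpret vector_space "scl A" using assms by (simp add: graded_space_def)
  have eq: "{(r, s, t). r + s + t = length [x, y, z] \<and> 1 \<le> s} =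
    {(0, 3, 0), (0, 2, 1), (1, 2, 0), (0, 1, 2), (1, 1, 1), (2, 1, 0)}"
  proof (rule set_eqI, clarify)
    fix r s t :: nat
    show "((r, s, t) \<in> {(r, s, t). r + s + t = length [x, y, z] \<and> 1 \<le> s}) =
      ((r, s, t) \<in> {(0, 3, 0), (0, 2, 1), (1, 2, 0), (0, 1, 2), (1, 1, 1), (2, 1, 0)})"
      unfolding mem_Collect_eq prod.case insert_iff prod.inject empty_iff list.size by presburger
  qed
  show ?thesis
    using assms(2-)
    unfolding insert_sum_def eq
    by (simp add: diff_def prd_def numeral_2_eq_2 numeral_3_eq_3)
qed

lemma dg_algebra_rules:
  assumes A: "dg_algebra A" and x: "x \<in> part A p" and y: "y \<in> part A q" and z: "z \<in> part A r"
  shows "diff A x \<in> part A (p + 1)"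
    and "prd A x y \<in> part A (p + q)"
    and "diff A (diff A x) = 0"
    and "diff A (prd A x y) = prd A (diff A x) y + scl A ((-1) powi p) (prd A x (diff A y))"
    and "prd A (prd A x y) z = prd A x (prd A y z)"
proof -
  have gr: "graded_space A"
    and ml: "\<And>n. 1 \<le> n \<Longrightarrow> multilinear_deg A A n (2 - int n) (mlt A n)"
    and st: "\<And>ds xs. 1 \<le> length xs \<Longrightarrow> homog A ds xs \<Longrightarrow> insert_sum A A (mlt A) ds xs = 0"
    and m3: "\<And>xs. length xs = 3 \<Longrightarrow> set xs \<subseteq> total_space A \<Longrightarrow> mlt A 3 xs = 0"
    using A by (auto simp: dg_algebra_def A_inf_algebra_def)
  interpret vector_space "scl A" using gr by (simp add: graded_space_def)
  have tot: "w \<in> total_space A" if "w \<in> part A k" for w k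
    using that by (auto simp: total_space_def intro: span_base)
  have d_deg: "diff A w \<in> part A (k + 1)" if "w \<in> part A k" for w k
  proof -
    have "homog A [k] [w]" using that by (simp add: homog_def)
    then have "mlt A 1 [w] \<in> part A (sum_list [k] + (2 - int 1))"
      using ml[of 1] unfolding multilinear_deg_def by (metis One_nat_def le_refl length_Cons list.size(3))
    then show ?thesis by (simp add: diff_def)
  qed
  show "diff A x \<in> part A (p + 1)" using x by (rule d_deg)
  have "homog A [p, q] [x, y]" using x y by (simp add: homog_def)
  then have "mlt A 2 [x, y] \<in> part A (sum_list [p, q] + (2 - int 2))"
    using ml[of 2] unfolding multilinear_deg_def
    by (metis One_nat_def Suc_1 le_add2 length_Cons list.size(3) plus_1_eq_Suc)
  then show "prd A x y \<in> part A (p + q)" by (simp add: prd_def)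
  have d0: "diff A 0 = 0"
  proof -
    have "mlt A 1 ([0][0 := scl A 0 0]) = scl A 0 (mlt A 1 ([0][0 := 0]))"
    proof -
      have "\<forall>xs i c x. length xs = 1 \<and> set xs \<subseteq> total_space A \<and> i < 1 \<and> x \<in> total_space A
          \<longrightarrow> mlt A 1 (xs[i := scl A c x]) = scl A c (mlt A 1 (xs[i := x]))"
        using ml[of 1] unfolding multilinear_deg_def by simp
      from this[rule_format, of "[0]" 0 0 0] show ?thesis
        by (simp add: total_space_def span_zero)
    qed
    then show ?thesis by (simp add: diff_def)
  qed
  show "diff A (diff A x) = 0"
    using st[of "[x]" "[p]"] x by (simp add: insert_sum_1[OF gr] homog_def)
  show "diff A (prd A x y) = prd A (diff A x) y + scl A ((-1) powi p) (prd A x (diff A y))"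
    using st[of "[x, y]" "[p, q]"] x y
    by (simp add: insert_sum_2[OF gr] homog_def diff_diff_eq)
  show "prd A (prd A x y) z = prd A x (prd A y z)"
    using st[of "[x, y, z]" "[p, q, r]"] x y z
    by (simp add: insert_sum_3[OF gr d0] m3 homog_def tot[of _ p] tot[of _ q] tot[of _ r]
        tot[OF d_deg[OF x]] tot[OF d_deg[OF y]] tot[OF d_deg[OF z]])
qed


section \<open>Massey products\<close>

text \<open>
  The classes are \<open>xs ! 0, ..., xs ! (n - 1)\<close>; e i j is the degree of the cochain a i j, and
  the scalar \<open>(-1) powi e i k\<close> turns a i k into its bar.
\<close>

definition massey_sum ::
  "('k::field, 'a::ab_group_add, 'm) ainf_scheme \<Rightarrow> (nat \<Rightarrow> nat \<Rightarrow> int) \<Rightarrow> (nat \<Rightarrow> nat \<Rightarrow> 'a)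
     \<Rightarrow> nat \<Rightarrow> nat \<Rightarrow> 'a" where
  "massey_sum A e a i j = (\<Sum>k\<in>{i<..<j}. prd A (scl A ((-1) powi e i k) (a i k)) (a k j))"

definition defining_system ::
  "('k::field, 'a::ab_group_add, 'm) ainf_scheme \<Rightarrow> 'a set list
     \<Rightarrow> (nat \<Rightarrow> nat \<Rightarrow> int) \<Rightarrow> (nat \<Rightarrow> nat \<Rightarrow> 'a) \<Rightarrow> bool" where
  "defining_system A xs e a \<longleftrightarrow>
     (\<forall>i j. i < j \<and> j \<le> length xs \<and> (i, j) \<noteq> (0, length xs) \<longrightarrow>
        a i j \<in> part A (e i j) \<and> diff A (a i j) = massey_sum A e a i j) \<and>
     (\<forall>i\<in>{1..length xs}. coh_class A (a (i - 1) i) = xs ! (i - 1))"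

definition massey_product ::
  "('k::field, 'a::ab_group_add, 'm) ainf_scheme \<Rightarrow> 'a set list \<Rightarrow> 'a set set" where
  "massey_product A xs =
     {coh_class A (massey_sum A e a 0 (length xs)) |e a. defining_system A xs e a}"

definition massey_defined ::
  "('k::field, 'a::ab_group_add, 'm) ainf_scheme \<Rightarrow> 'a set list \<Rightarrow> bool" where
  "massey_defined A xs \<longleftrightarrow> (\<exists>e a. defining_system A xs e a)"

definition massey_vanishes ::
  "('k::field, 'a::ab_group_add, 'm) ainf_scheme \<Rightarrow> 'a set list \<Rightarrow> bool" where
  "massey_vanishes A xs \<longleftrightarrow> coh_class A 0 \<in> massey_product A xs"

end

theory Submission
  imports Defs
begin

text \<open>
  Let H be the cohomology of A, realised as the image of a projection P of A, and give H zero
  operations.  An \<open>A\<^sub>\<infinity>\<close>-morphism from A to H is then a sequence of multilinear maps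
  \<open>f\<^sub>n\<close> such that
  \<open>f\<^sub>n \<circ> d = (-1)\<^sup>n f\<^sub>n\<^sub>-\<^sub>1 \<circ> \<mu>\<close>, where d is the differential of the tensor power and
  \<open>\<mu>\<close> is the alternating sum of the multiplications of two neighbouring entries.  Start with
  \<open>f\<^sub>1 = P\<close>, which induces the identity on cohomology, so that only the existence of the higher
  maps is at stake.

  Given the maps up to \<open>f\<^sub>n\<close>, the map \<open>\<phi> = f\<^sub>n \<circ> \<mu>\<close> satisfies \<open>\<phi> \<circ> d = 0\<close>, because
  \<open>d\<close> commutes with \<open>\<mu>\<close> and \<open>\<mu> \<circ> \<mu> = 0\<close> by associativity.  A contraction of A onto H induces
  a contraction of every tensor power, with homotopy h, and
  \<open>\<phi> \<circ> h \<circ> d = \<phi> - \<phi> \<circ> P\<^sup>\<otimes>\<close> (lemma \<open>pre_d_pre_h_homotopy\<close>).  Hence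
  \<open>f\<^sub>n\<^sub>+\<^sub>1 = \<plusminus> \<phi> \<circ> h\<close> is the next map as soon as \<open>\<phi>\<close> vanishes on cocycles in the image of P
  (lemma \<open>mor_rel_Suc\<close>).

  On cocycles \<open>\<phi>\<close> is the Massey product.  A defining system a for n + 1 classes gives an element W
  of the bar construction of A, the sum over all subdivisions
  \<open>0 = j\<^sub>0 < \<dots> < j\<^sub>k = n + 1\<close> of \<open>[a\<^bsub>j0 j1\<^esub> | \<dots> | a\<^bsub>j(k-1) jk\<^esub>]\<close> with suitable signs.
  In its boundary everything cancels but the terms that concern the missing entry
  \<open>a\<^bsub>0,n+1\<^esub>\<close> (lemma \<open>chain_defect\<close>).  Evaluating \<open>f\<^sub>1, \<dots>, f\<^sub>n\<close> on this boundary shows that,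
  up to sign, \<open>\<phi>\<close> of the classes is P of the Massey cochain of a, for every defining system a
  (lemma \<open>obstruction_eq_massey\<close>).  This gives two things.  Since the obstructions of lower arity
  were zero, all shorter Massey cochains are exact, so a defining system exists: solve the equations
  with the contracting homotopy (lemma \<open>transfer_sys_d\<close>).  And since the value does not depend on the
  system, it is zero as soon as one system has an exact Massey cochain, which is the hypothesis on
  Massey products, or, for n + 1 = 2, the hypothesis on the product of H.
\<close>


section \<open>Differential graded algebras with a contraction\<close>

text \<open>
  A dg-algebra with a homogeneous map h that solves \<open>d y = x\<close> for exact x.  The map bar is
  \<open>(-1)\<^sup>p\<close> on degree p; having the Koszul sign as an operator allows identities between
  multilinear maps to be stated without degrees.  All maps are linear on the whole type, while the
  axioms only concern the graded subspace.  The axioms on h are what makes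
  \<open>P = 1 - d h - h d\<close> a projection onto a space of cocycles that represents the cohomology.
\<close>

locale contracted_dga = vector_space scl
  for scl :: "'k::field \<Rightarrow> 'a::ab_group_add \<Rightarrow> 'a" (infixr "*s" 75) +
  fixes G :: "int \<Rightarrow> 'a set"
    and d bar h :: "'a \<Rightarrow> 'a"
    and m :: "'a \<Rightarrow> 'a \<Rightarrow> 'a" (infixl "\<cdot>" 70)
  assumes subspace_G: "subspace (G p)"
    and lin_d: "Vector_Spaces.linear scl scl d"
    and lin_bar: "Vector_Spaces.linear scl scl bar"
    and lin_h: "Vector_Spaces.linear scl scl h"
    and lin_m_left: "Vector_Spaces.linear scl scl (\<lambda>x. x \<cdot> y)"
    and lin_m_right: "Vector_Spaces.linear scl scl (\<lambda>y. x \<cdot> y)"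
    and d_G: "x \<in> G p \<Longrightarrow> d x \<in> G (p + 1)"
    and h_G: "x \<in> G p \<Longrightarrow> h x \<in> G (p - 1)"
    and m_G: "x \<in> G p \<Longrightarrow> y \<in> G q \<Longrightarrow> x \<cdot> y \<in> G (p + q)"
    and bar_hom: "x \<in> G p \<Longrightarrow> bar x = (-1) powi p *s x"
    and dd_hom: "x \<in> G p \<Longrightarrow> d (d x) = 0"
    and leibniz_hom: "x \<in> G p \<Longrightarrow> y \<in> G q \<Longrightarrow> d (x \<cdot> y) = d x \<cdot> y + bar x \<cdot> d y"
    and assoc_hom: "x \<in> G p \<Longrightarrow> y \<in> G q \<Longrightarrow> z \<in> G r \<Longrightarrow> (x \<cdot> y) \<cdot> z = x \<cdot> (y \<cdot> z)"
    and dhd_hom: "x \<in> G p \<Longrightarrow> d (h (d x)) = d x"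
    and dhhd_hom: "x \<in> G p \<Longrightarrow> d (h (h (d x))) = 0"
begin

sublocale vs: vector_space_pair scl scl ..

abbreviation lin :: "('a \<Rightarrow> 'a) \<Rightarrow> bool" where
  "lin \<equiv> Vector_Spaces.linear scl scl"

definition T :: "'a set" where
  "T = span (\<Union>p. G p)"

definition P :: "'a \<Rightarrow> 'a" where
  "P x = x - d (h x) - h (d x)"

lemma lin_compose: "lin f \<Longrightarrow> lin g \<Longrightarrow> lin (\<lambda>x. f (g x))"
  using Vector_Spaces.linear_compose[of scl scl g scl f] by (simp add: comp_def)

lemma lin_id: "lin (\<lambda>x. x)"
  using linear_id by (simp add: id_def)

lemmas lin_intros = vs.linear_compose_add vs.linear_compose_sub vs.linear_compose_neg
  vs.linear_zero vs.linear_compose_scale_right lin_id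

lemma lin_P: "lin P"
  unfolding P_def[abs_def]
  by (intro lin_intros lin_compose[OF lin_d] lin_compose[OF lin_h] lin_d lin_h)

lemmas lin_ops = lin_d lin_bar lin_h lin_P

lemmas ops_add [simp] = lin_ops[THEN vs.linear_add]
lemmas ops_diff [simp] = lin_ops[THEN vs.linear_diff]
lemmas ops_neg [simp] = lin_ops[THEN vs.linear_neg]
lemmas ops_zero [simp] = lin_ops[THEN vs.linear_0]
lemmas ops_scale [simp] = lin_ops[THEN vs.linear_scale]
lemmas ops_sum = lin_ops[THEN vs.linear_sum]

lemmas m_neg_left [simp] = lin_m_left[THEN vs.linear_neg]
lemmas m_neg_right [simp] = lin_m_right[THEN vs.linear_neg]
lemmas m_zero_left [simp] = lin_m_left[THEN vs.linear_0]
lemmas m_zero_right [simp] = lin_m_right[THEN vs.linear_0]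
lemmas m_sum_left = lin_m_left[THEN vs.linear_sum]
lemmas m_sum_right = lin_m_right[THEN vs.linear_sum]

lemma T_G: "x \<in> G p \<Longrightarrow> x \<in> T"
  unfolding T_def by (rule span_base) auto

lemma T_subspace: "subspace T"
  unfolding T_def by (rule subspace_span)

lemmas T_closed [simp] = subspace_add[OF T_subspace] subspace_diff[OF T_subspace]
  subspace_neg[OF T_subspace] subspace_0[OF T_subspace] subspace_scale[OF T_subspace]

lemma T_eqI:
  assumes "x \<in> T" "lin f" "lin g" "\<And>p y. y \<in> G p \<Longrightarrow> f y = g y"
  shows "f x = g x"
  using assms(1) unfolding T_def
  by (rule vs.linear_eq_on_span[OF assms(2,3), rotated]) (use assms(4) in auto)

lemma T_mapI:
  assumes "x \<in> T" "lin f" "\<And>p y. y \<in> G p \<Longrightarrow> f y \<in> T"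
  shows "f x \<in> T"
proof -
  have "subspace {x. f x \<in> T}"
    by (simp add: subspace_def vs.linear_0[OF assms(2)] vs.linear_add[OF assms(2)]
        vs.linear_scale[OF assms(2)])
  with assms(1) show ?thesis
    unfolding T_def by (rule span_induct) (use assms(3) in \<open>auto simp: T_def\<close>)
qed

lemma G_scale: "x \<in> G p \<Longrightarrow> c *s x \<in> G p"
  by (rule subspace_scale[OF subspace_G])

lemma bar_G: "x \<in> G p \<Longrightarrow> bar x \<in> G p"
  by (simp add: bar_hom G_scale)

lemma P_G: "x \<in> G p \<Longrightarrow> P x \<in> G p"
  unfolding P_def using d_G[OF h_G, of x p] h_G[OF d_G, of x p]
  by (simp add: subspace_diff[OF subspace_G])

lemma T_d [simp]: "x \<in> T \<Longrightarrow> d x \<in> T"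
  and T_h [simp]: "x \<in> T \<Longrightarrow> h x \<in> T"
  and T_bar [simp]: "x \<in> T \<Longrightarrow> bar x \<in> T"
  by (rule T_mapI; fast intro: lin_ops T_G d_G h_G bar_G)+

lemma T_P [simp]: "x \<in> T \<Longrightarrow> P x \<in> T"
  by (simp add: P_def)

lemma T_m [simp]:
  assumes "x \<in> T" "y \<in> T" shows "x \<cdot> y \<in> T"
  using assms(1) lin_m_left
proof (rule T_mapI)
  fix p x' assume x': "x' \<in> G p"
  show "x' \<cdot> y \<in> T"
    using assms(2) lin_m_right by (rule T_mapI) (use T_G m_G x' in blast)
qed

lemma bar_bar [simp]: "x \<in> T \<Longrightarrow> bar (bar x) = x"
  by (rule T_eqI[where f = "\<lambda>x. bar (bar x)"])
    (auto simp: bar_hom lin_compose lin_bar lin_id power_int_mult_distrib[symmetric])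

lemma d_bar: "x \<in> T \<Longrightarrow> d (bar x) = - bar (d x)"
  by (rule T_eqI[where f = "\<lambda>x. d (bar x)"])
    (auto simp: bar_hom[OF d_G] bar_hom lin_compose lin_d lin_bar power_int_add intro: lin_intros)

lemma bar_h: "x \<in> T \<Longrightarrow> bar (h x) = - h (bar x)"
  by (rule T_eqI[where f = "\<lambda>x. bar (h x)"])
    (auto simp: bar_hom[OF h_G] bar_hom lin_compose lin_h lin_bar power_int_diff intro: lin_intros)

lemma bar_P: "x \<in> T \<Longrightarrow> bar (P x) = P (bar x)"
  by (rule T_eqI[where f = "\<lambda>x. bar (P x)"])
    (auto simp: bar_hom[OF P_G] bar_hom lin_compose lin_P lin_bar)

lemma d_d [simp]: "x \<in> T \<Longrightarrow> d (d x) = 0"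
  by (rule T_eqI[where f = "\<lambda>x. d (d x)"])
    (auto simp: dd_hom lin_compose lin_d vs.linear_zero)

lemma d_h_d: "x \<in> T \<Longrightarrow> d (h (d x)) = d x"
  by (rule T_eqI[where f = "\<lambda>x. d (h (d x))"])
    (auto simp: dhd_hom intro!: lin_compose[OF lin_d] lin_compose[OF lin_h] lin_d)

lemma d_h_h_d: "x \<in> T \<Longrightarrow> d (h (h (d x))) = 0"
  by (rule T_eqI[where f = "\<lambda>x. d (h (h (d x)))"])
    (auto simp: dhhd_hom vs.linear_zero intro!: lin_compose[OF lin_d] lin_compose[OF lin_h] lin_d)

lemma bar_m:
  assumes "x \<in> T" "y \<in> T" shows "bar (x \<cdot> y) = bar x \<cdot> bar y"
proof (rule T_eqI[OF assms(1), where f = "\<lambda>x. bar (x \<cdot> y)" and g = "\<lambda>x. bar x \<cdot> bar y"])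
  fix p x assume x: "x \<in> G p"
  show "bar (x \<cdot> y) = bar x \<cdot> bar y"
  proof (rule T_eqI[OF assms(2), where f = "\<lambda>y. bar (x \<cdot> y)" and g = "\<lambda>y. bar x \<cdot> bar y"])
    fix q y assume y: "y \<in> G q"
    show "bar (x \<cdot> y) = bar x \<cdot> bar y"
      using x y
      by (simp add: bar_hom[OF m_G[OF x y]] bar_hom power_int_add
          lin_m_left[THEN vs.linear_scale] lin_m_right[THEN vs.linear_scale])
  qed (intro lin_compose[OF lin_bar] lin_compose[OF lin_m_right] lin_m_right lin_bar)+
qed (intro lin_compose[OF lin_bar] lin_compose[OF lin_m_left] lin_m_left lin_bar)+

lemma leibniz:
  assumes "x \<in> T" "y \<in> T" shows "d (x \<cdot> y) = d x \<cdot> y + bar x \<cdot> d y"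
proof (rule T_eqI[OF assms(1), where f = "\<lambda>x. d (x \<cdot> y)" and g = "\<lambda>x. d x \<cdot> y + bar x \<cdot> d y"])
  fix p x assume x: "x \<in> G p"
  show "d (x \<cdot> y) = d x \<cdot> y + bar x \<cdot> d y"
  proof (rule T_eqI[OF assms(2), where f = "\<lambda>y. d (x \<cdot> y)" and g = "\<lambda>y. d x \<cdot> y + bar x \<cdot> d y"])
    fix q y assume y: "y \<in> G q"
    show "d (x \<cdot> y) = d x \<cdot> y + bar x \<cdot> d y" by (rule leibniz_hom[OF x y])
  qed (intro lin_intros lin_compose[OF lin_d] lin_compose[OF lin_m_right] lin_m_right lin_d)+
qed (intro lin_intros lin_compose[OF lin_d] lin_compose[OF lin_m_left] lin_m_left lin_d lin_bar)+

lemma assoc: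
  assumes "x \<in> T" "y \<in> T" "z \<in> T" shows "(x \<cdot> y) \<cdot> z = x \<cdot> (y \<cdot> z)"
proof (rule T_eqI[OF assms(1), where f = "\<lambda>x. (x \<cdot> y) \<cdot> z" and g = "\<lambda>x. x \<cdot> (y \<cdot> z)"])
  fix p x assume x: "x \<in> G p"
  show "(x \<cdot> y) \<cdot> z = x \<cdot> (y \<cdot> z)"
  proof (rule T_eqI[OF assms(2), where f = "\<lambda>y. (x \<cdot> y) \<cdot> z" and g = "\<lambda>y. x \<cdot> (y \<cdot> z)"])
    fix q y assume y: "y \<in> G q"
    show "(x \<cdot> y) \<cdot> z = x \<cdot> (y \<cdot> z)"
    proof (rule T_eqI[OF assms(3), where f = "\<lambda>z. (x \<cdot> y) \<cdot> z" and g = "\<lambda>z. x \<cdot> (y \<cdot> z)"])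
      fix r z assume z: "z \<in> G r"
      show "(x \<cdot> y) \<cdot> z = x \<cdot> (y \<cdot> z)" by (rule assoc_hom[OF x y z])
    qed (intro lin_compose[OF lin_m_right] lin_m_right)+
  qed (intro lin_compose[OF lin_m_left] lin_compose[OF lin_m_right] lin_m_left lin_m_right)+
qed (intro lin_compose[OF lin_m_left] lin_m_left)+

lemma P_d [simp]: "x \<in> T \<Longrightarrow> P (d x) = 0"
  and d_P [simp]: "x \<in> T \<Longrightarrow> d (P x) = 0"
  by (simp_all add: P_def d_h_d)

lemma P_P: "x \<in> T \<Longrightarrow> P (P x) = P x"
proof -
  assume x: "x \<in> T"
  \<comment> \<open>This is where the square of h must vanish between two differentials.\<close>
  have "d (h (P x)) = 0"
    using x by (simp add: P_def[of x] d_h_d d_h_h_d)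
  then show ?thesis using x by (subst P_def) simp
qed


section \<open>Operators on functions of lists\<close>

text \<open>
  Multilinear maps on tensor powers are functions of lists, and instead of operators on tensor
  powers there are the operators of precomposition with them: \<open>pre_d\<close> for the differential,
  \<open>pre_h\<close> for the homotopy \<open>\<Sum> P \<otimes> \<dots> \<otimes> P \<otimes> h \<otimes> 1 \<otimes> \<dots> \<otimes> 1\<close>, and \<open>pre_m\<close> for the alternating sum
  of multiplications of neighbours.  They recurse over the list and absorb its head into the
  function, so that identities between them follow by one induction that is general in the
  function.  Linearity in every entry is required for all lengths at once for the same reason.
\<close>

definition mlin :: "('a list \<Rightarrow> 'a) \<Rightarrow> bool" where
  "mlin F \<longleftrightarrow> (\<forall>us vs. lin (\<lambda>x. F (us @ x # vs)))"

primrec pre_d :: "('a list \<Rightarrow> 'a) \<Rightarrow> 'a list \<Rightarrow> 'a" where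
  "pre_d F [] = 0"
| "pre_d F (x # xs) = F (d x # xs) + pre_d (\<lambda>ys. F (bar x # ys)) xs"

primrec pre_h :: "('a list \<Rightarrow> 'a) \<Rightarrow> 'a list \<Rightarrow> 'a" where
  "pre_h F [] = 0"
| "pre_h F (x # xs) = F (h x # xs) + pre_h (\<lambda>ys. F (bar (P x) # ys)) xs"

definition merge_head :: "('a list \<Rightarrow> 'a) \<Rightarrow> 'a \<Rightarrow> 'a list \<Rightarrow> 'a" where
  "merge_head F x xs = (case xs of [] \<Rightarrow> 0 | y # ys \<Rightarrow> F (x \<cdot> y # ys))"

primrec pre_m :: "('a list \<Rightarrow> 'a) \<Rightarrow> 'a list \<Rightarrow> 'a" where
  "pre_m F [] = 0"
| "pre_m F (x # xs) = merge_head F x xs - pre_m (\<lambda>ys. F (x # ys)) xs"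

lemma merge_head_simps [simp]: "merge_head F x [] = 0" "merge_head F x (y # ys) = F (x \<cdot> y # ys)"
  by (simp_all add: merge_head_def)

lemma mlin_Cons: "mlin F \<Longrightarrow> mlin (\<lambda>ys. F (x # ys))"
  unfolding mlin_def
proof (intro allI)
  fix us vs
  assume "\<forall>us vs. lin (\<lambda>y. F (us @ y # vs))"
  from this[rule_format, of "x # us" vs] show "lin (\<lambda>y. F (x # us @ y # vs))" by simp
qed

lemma mlin_lin: "mlin F \<Longrightarrow> lin (\<lambda>x. F (us @ x # vs))"
  unfolding mlin_def by blast

lemma mlin_lin_Cons: "mlin F \<Longrightarrow> lin (\<lambda>x. F (x # vs))"
  using mlin_lin[of F "[]"] by simp

lemma lin_pre_h: "(\<And>ys. lin (\<lambda>x. F x ys)) \<Longrightarrow> lin (\<lambda>x. pre_h (F x) xs)"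
  by (induction xs arbitrary: F) (auto intro!: lin_intros)

lemma lin_pre_m: "(\<And>ys. lin (\<lambda>x. F x ys)) \<Longrightarrow> lin (\<lambda>x. pre_m (F x) xs)"
proof (induction xs arbitrary: F)
  case (Cons x xs)
  have "lin (\<lambda>y. merge_head (F y) x xs)"
    using Cons.prems by (cases xs) (auto intro: lin_intros)
  then show ?case
    using Cons by (auto intro!: lin_intros)
qed (auto intro: lin_intros)

lemma mlin_pre_h: assumes "mlin F" shows "mlin (pre_h F)"
  unfolding mlin_def
proof (intro allI)
  fix us vs
  show "lin (\<lambda>x. pre_h F (us @ x # vs))"
    using assms
  proof (induction us arbitrary: F)
    case Nil
    have 1: "lin (\<lambda>x. F (h x # vs))"
      by (rule lin_compose[OF mlin_lin_Cons[OF Nil] lin_h])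
    have 2: "lin (\<lambda>x. pre_h (\<lambda>ys. F (bar (P x) # ys)) vs)"
      by (rule lin_pre_h, rule lin_compose[OF mlin_lin_Cons[OF Nil] lin_compose[OF lin_bar lin_P]])
    show ?case
      using vs.linear_compose_add[OF 1 2] by simp
  next
    case (Cons u us)
    have "lin (\<lambda>x. pre_h (\<lambda>ys. F (bar (P u) # ys)) (us @ x # vs))"
      by (rule Cons.IH) (rule mlin_Cons[OF Cons.prems])
    from vs.linear_compose_add[OF mlin_lin[OF Cons.prems, of "h u # us" vs] this]
    show ?case by simp
  qed
qed

lemma mlin_pre_m: assumes "mlin F" shows "mlin (pre_m F)"
  unfolding mlin_def
proof (intro allI)
  fix us vs
  show "lin (\<lambda>x. pre_m F (us @ x # vs))"
    using assms
  proof (induction us arbitrary: F)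
    case Nil
    have 1: "lin (\<lambda>x. merge_head F x vs)"
      by (cases vs) (simp_all add: vs.linear_zero lin_compose[OF mlin_lin_Cons[OF Nil] lin_m_left])
    have 2: "lin (\<lambda>x. pre_m (\<lambda>ys. F (x # ys)) vs)"
      by (rule lin_pre_m) (rule mlin_lin_Cons[OF Nil])
    show ?case
      using vs.linear_compose_sub[OF 1 2] by simp
  next
    case (Cons u us)
    have 1: "lin (\<lambda>x. merge_head F u (us @ x # vs))"
    proof (cases us)
      case Nil
      then show ?thesis
        by (simp add: lin_compose[OF mlin_lin_Cons[OF Cons.prems] lin_m_right])
    next
      case (Cons u' us')
      then show ?thesis
        using mlin_lin[OF \<open>mlin F\<close>, of "u \<cdot> u' # us'"] by simp
    qed
    have "lin (\<lambda>x. pre_m (\<lambda>ys. F (u # ys)) (us @ x # vs))"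
      by (rule Cons.IH) (rule mlin_Cons[OF Cons.prems])
    from vs.linear_compose_sub[OF 1 this] show ?case by simp
  qed
qed

lemma mlin_scale: "mlin F \<Longrightarrow> mlin (\<lambda>xs. c *s F xs)"
  unfolding mlin_def using vs.linear_compose_scale_right by metis

text \<open>
  Tensors of homogeneous elements span: this is how a statement on Massey products, which concerns
  homogeneous classes, controls a multilinear map.
\<close>

lemma mlin_vanish:
  assumes "mlin F" "set xs \<subseteq> T"
    and "\<And>ys. length ys = length xs \<Longrightarrow> set ys \<subseteq> (\<Union>p. G p) \<Longrightarrow> F ys = 0"
  shows "F xs = 0"
  using assms
proof (induction xs arbitrary: F)
  case (Cons x xs)
  have "F (y # xs) = 0" if "y \<in> G p" for p y
  proof (rule Cons.IH[of "\<lambda>ys. F (y # ys)"])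
    fix ys assume "length ys = length xs" "set ys \<subseteq> (\<Union>p. G p)"
    then show "F (y # ys) = 0" using that by (intro Cons.prems) auto
  qed (use Cons.prems mlin_Cons in auto)
  then show ?case
    by (intro T_eqI[of x "\<lambda>x. F (x # xs)" "\<lambda>_. 0"])
      (use Cons.prems mlin_lin_Cons vs.linear_zero in auto)
qed simp

lemma pre_h_cong:
  "(\<And>ys. length ys = length xs \<Longrightarrow> set ys \<subseteq> T \<Longrightarrow> F ys = F' ys) \<Longrightarrow> set xs \<subseteq> T \<Longrightarrow> pre_h F xs = pre_h F' xs"
proof (induction xs arbitrary: F F')
  case (Cons x xs)
  have "pre_h (\<lambda>ys. F (bar (P x) # ys)) xs = pre_h (\<lambda>ys. F' (bar (P x) # ys)) xs"
    by (rule Cons.IH) (use Cons.prems in auto)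
  moreover have "F (h x # xs) = F' (h x # xs)"
    by (rule Cons.prems(1)) (use Cons.prems(2) in auto)
  ultimately show ?case by simp
qed simp

lemma pre_m_cong:
  "(\<And>ys. Suc (length ys) = length xs \<Longrightarrow> set ys \<subseteq> T \<Longrightarrow> F ys = F' ys) \<Longrightarrow> set xs \<subseteq> T
   \<Longrightarrow> pre_m F xs = pre_m F' xs"
proof (induction xs arbitrary: F F')
  case (Cons x xs)
  have "merge_head F x xs = merge_head F' x xs"
  proof (cases xs)
    case xs: (Cons y ys)
    have "F (x \<cdot> y # ys) = F' (x \<cdot> y # ys)"
      by (rule Cons.prems(1)) (use Cons.prems(2) xs in auto)
    then show ?thesis using xs by simp
  qed simp
  moreover have "pre_m (\<lambda>ys. F (x # ys)) xs = pre_m (\<lambda>ys. F' (x # ys)) xs"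
    by (rule Cons.IH) (use Cons.prems in auto)
  ultimately show ?case by simp
qed simp

lemma pre_add:
  "pre_d (\<lambda>ys. F ys + F' ys) xs = pre_d F xs + pre_d F' xs"
  "pre_h (\<lambda>ys. F ys + F' ys) xs = pre_h F xs + pre_h F' xs"
  "pre_m (\<lambda>ys. F ys + F' ys) xs = pre_m F xs + pre_m F' xs"
  by (induction xs arbitrary: F F') (simp_all add: merge_head_def algebra_simps split: list.split)

lemma pre_diff:
  "pre_d (\<lambda>ys. F ys - F' ys) xs = pre_d F xs - pre_d F' xs"
  "pre_m (\<lambda>ys. F ys - F' ys) xs = pre_m F xs - pre_m F' xs"
  by (induction xs arbitrary: F F') (simp_all add: merge_head_def split: list.split)

lemma pre_scale:
  "pre_d (\<lambda>ys. c *s F ys) xs = c *s pre_d F xs"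
  "pre_m (\<lambda>ys. c *s F ys) xs = c *s pre_m F xs"
  by (induction xs arbitrary: F)
    (simp_all add: merge_head_def scale_right_distrib scale_right_diff_distrib split: list.split)

lemma pre_zero [simp]:
  "pre_d (\<lambda>ys. 0) xs = 0" "pre_h (\<lambda>ys. 0) xs = 0" "pre_m (\<lambda>ys. 0) xs = 0"
  by (induction xs) (auto simp: merge_head_def split: list.split)

text \<open>
  The contraction of a tensor power.  Where d and h meet different entries the terms cancel, since h
  anticommutes with bar; where they meet the same entry they give \<open>1 - P\<close> there, and the sum over
  the entries telescopes.
\<close>

lemma pre_d_pre_h_homotopy:
  assumes "mlin F" "set xs \<subseteq> T"
  shows "pre_d (pre_h F) xs + pre_h (pre_d F) xs = F xs - F (map P xs)"
  using assms
proof (induction xs arbitrary: F)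
  case (Cons x xs)
  then have x: "x \<in> T" and xs: "set xs \<subseteq> T" by auto
  note F = mlin_lin_Cons[OF Cons.prems(1)]
  have z: "F (0 # ys) = 0" for ys using vs.linear_0[OF F] .
  have a: "pre_d (\<lambda>ys. F (h (bar x) # ys)) xs + pre_d (\<lambda>ys. F (bar (h x) # ys)) xs = 0"
    using x by (simp add: pre_add(1)[symmetric] bar_h vs.linear_neg[OF F])
  have b: "F (h (d x) # xs) + F (d (h x) # xs) = F (x # xs) - F (P x # xs)"
    by (simp add: P_def vs.linear_diff[OF F])
  have "pre_d (pre_h F) (x # xs) + pre_h (pre_d F) (x # xs)
    = (F (h (d x) # xs) + F (d (h x) # xs))
      + (pre_d (\<lambda>ys. F (h (bar x) # ys)) xs + pre_d (\<lambda>ys. F (bar (h x) # ys)) xs)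
      + (pre_d (pre_h (\<lambda>ys. F (P x # ys))) xs + pre_h (pre_d (\<lambda>ys. F (P x # ys))) xs)"
    using x by (simp add: pre_add z d_bar bar_P[of "bar x", symmetric] bar_P algebra_simps)
  then show ?case
    using Cons.IH[OF mlin_Cons[OF Cons.prems(1)] xs] a b by simp
qed simp

text \<open>
  Two multiplications at disjoint places cancel because of the alternating sign, two at adjoining
  places because of associativity.
\<close>

lemma pre_m_pre_m:
  assumes "set xs \<subseteq> T"
  shows "pre_m (pre_m F) xs = 0"
  using assms
proof (induction xs arbitrary: F)
  case (Cons x xs)
  then have IH: "pre_m (pre_m (\<lambda>ys. F (x # ys))) xs = 0" by simp
  show ?case
  proof (cases xs)
    case xs: (Cons y zs)
    show ?thesis
    proof (cases zs)
      case Nil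
      then show ?thesis by (simp add: xs)
    next
      case (Cons z ws)
      then show ?thesis
        using IH Cons.prems xs by (simp add: pre_diff assoc)
    qed
  qed simp
qed simp

lemma pre_d_pre_m:
  assumes "mlin F" "set xs \<subseteq> T"
  shows "pre_d (pre_m F) xs = pre_m (pre_d F) xs"
  using assms
proof (induction xs arbitrary: F)
  case (Cons x xs)
  note IH = Cons.IH[OF mlin_Cons[OF Cons.prems(1)]]
  show ?case
  proof (cases xs)
    case xs: (Cons y zs)
    have x: "x \<in> T" "y \<in> T" "set zs \<subseteq> T" using xs Cons.prems by auto
    note F = mlin_lin_Cons[OF Cons.prems(1)]
    have "F (d (x \<cdot> y) # zs) = F (d x \<cdot> y # zs) + F (bar x \<cdot> d y # zs)"
      using x by (simp add: leibniz vs.linear_add[OF F])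
    then show ?thesis
      using IH[of "bar x"] x by (simp add: xs pre_diff pre_add bar_m algebra_simps)
  qed simp
qed simp


section \<open>The components of the morphism\<close>

text \<open>
  The value off lists of length 1 of the first component is 0, since a multilinear function has to
  be linear in every entry of lists of every length.
\<close>

primrec mor :: "nat \<Rightarrow> 'a list \<Rightarrow> 'a" where
  "mor 0 = (\<lambda>_. 0)"
| "mor (Suc n) = (if n = 0 then (\<lambda>xs. case xs of [x] \<Rightarrow> P x | _ \<Rightarrow> 0)
     else (\<lambda>xs. (-1) ^ Suc n *s pre_h (pre_m (mor n)) xs))"

declare mor.simps(2) [simp del]

lemma mor_1 [simp]: "mor (Suc 0) [x] = P x"
  by (simp add: mor.simps(2))

lemma mlin_mor: "mlin (mor n)"
proof (induction n)
  case 0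
  then show ?case by (simp add: mlin_def vs.linear_zero)
next
  case (Suc n)
  show ?case
  proof (cases "n = 0")
    case True
    have "lin (\<lambda>x. case us @ x # vs of [x] \<Rightarrow> P x | _ \<Rightarrow> 0)" for us vs
      by (cases us; cases vs; cases "tl us") (auto simp: lin_P vs.linear_zero split: list.split)
    then show ?thesis using True by (simp add: mlin_def mor.simps(2))
  next
    case False
    then show ?thesis
      using mlin_scale[OF mlin_pre_h[OF mlin_pre_m[OF Suc]]] by (simp add: mor.simps(2) del: power_Suc)
  qed
qed

text \<open>
  Multilinear of arity n and degree q, into the graded space with parts Q.
\<close>

definition hdeg :: "(int \<Rightarrow> 'a set) \<Rightarrow> nat \<Rightarrow> int \<Rightarrow> ('a list \<Rightarrow> 'a) \<Rightarrow> bool" where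
  "hdeg Q n q F \<longleftrightarrow> (\<forall>ds xs. length xs = n \<longrightarrow> list_all2 (\<lambda>p x. x \<in> G p) ds xs \<longrightarrow>
     F xs \<in> Q (sum_list ds + q))"

lemma hdegD:
  "hdeg Q n q F \<Longrightarrow> length xs = n \<Longrightarrow> list_all2 (\<lambda>p x. x \<in> G p) ds xs \<Longrightarrow> sum_list ds + q = r
   \<Longrightarrow> F xs \<in> Q r"
  unfolding hdeg_def by blast

lemma hdeg_Cons: "hdeg Q (Suc n) q F \<Longrightarrow> x \<in> G p \<Longrightarrow> hdeg Q n (p + q) (\<lambda>ys. F (x # ys))"
  unfolding hdeg_def
proof (intro allI impI, goal_cases)
  case (1 ds xs)
  then show ?case
    using 1(1)[rule_format, of "x # xs" "p # ds"] by (simp add: algebra_simps)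
qed

lemma hdeg_pre_h:
  assumes Q: "\<And>p. subspace (Q p)"
  shows "hdeg Q n q F \<Longrightarrow> hdeg Q n (q - 1) (pre_h F)"
proof (induction n arbitrary: F q)
  case 0
  then show ?case by (simp add: hdeg_def subspace_0[OF Q])
next
  case (Suc n)
  show ?case
    unfolding hdeg_def
  proof (intro allI impI)
    fix ds :: "int list" and xs :: "'a list"
    assume "length xs = Suc n" "list_all2 (\<lambda>p x. x \<in> G p) ds xs"
    then obtain p ps x ys where *: "ds = p # ps" "xs = x # ys" "x \<in> G p" "length ys = n"
      "list_all2 (\<lambda>p x. x \<in> G p) ps ys"
      by (auto simp: length_Suc_conv list_all2_Cons2)
    have "F (h x # ys) \<in> Q (sum_list ds + (q - 1))"
      by (rule hdegD[OF Suc.prems, where ds = "(p - 1) # ps"]) (use * in \<open>auto simp: h_G\<close>)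
    moreover have "pre_h (\<lambda>ys. F (bar (P x) # ys)) ys \<in> Q (sum_list ds + (q - 1))"
      by (rule hdegD[OF Suc.IH[OF hdeg_Cons[OF Suc.prems bar_G[OF P_G[OF *(3)]]]], where ds = ps])
        (use * in auto)
    ultimately show "pre_h F xs \<in> Q (sum_list ds + (q - 1))"
      using * by (simp add: subspace_add[OF Q])
  qed
qed

lemma hdeg_pre_m:
  assumes Q: "\<And>p. subspace (Q p)"
  shows "hdeg Q n q F \<Longrightarrow> hdeg Q (Suc n) q (pre_m F)"
proof (induction n arbitrary: F q)
  case 0
  then show ?case by (auto simp: hdeg_def length_Suc_conv subspace_0[OF Q])
next
  case (Suc n)
  show ?case
    unfolding hdeg_def
  proof (intro allI impI)
    fix ds :: "int list" and xs :: "'a list"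
    assume "length xs = Suc (Suc n)" "list_all2 (\<lambda>p x. x \<in> G p) ds xs"
    then obtain p p' ps x y ys where *: "ds = p # p' # ps" "xs = x # y # ys" "x \<in> G p" "y \<in> G p'"
      "length ys = n" "list_all2 (\<lambda>p x. x \<in> G p) ps ys"
      by (auto simp: length_Suc_conv list_all2_Cons2)
    have "F (x \<cdot> y # ys) \<in> Q (sum_list ds + q)"
      by (rule hdegD[OF Suc.prems, where ds = "(p + p') # ps"]) (use * in \<open>auto simp: m_G\<close>)
    moreover have "pre_m (\<lambda>ys. F (x # ys)) (y # ys) \<in> Q (sum_list ds + q)"
      by (rule hdegD[OF Suc.IH[OF hdeg_Cons[OF Suc.prems *(3)]], where ds = "p' # ps"])
        (use * in auto)
    ultimately show "pre_m F xs \<in> Q (sum_list ds + q)"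
      using * by (simp add: subspace_diff[OF Q])
  qed
qed

lemma subspace_PG: "subspace (P ` G p)"
  by (rule vs.linear_subspace_image[OF lin_P subspace_G])

lemma hdeg_mor: "1 \<le> n \<Longrightarrow> hdeg (\<lambda>p. P ` G p) n (1 - int n) (mor n)"
proof (induction n rule: nat_induct_at_least)
  case base
  show ?case
    by (auto simp: hdeg_def length_Suc_conv list_all2_Cons2)
next
  case (Suc n)
  have "hdeg (\<lambda>p. P ` G p) (Suc n) (1 - int n - 1) (pre_h (pre_m (mor n)))"
    by (intro hdeg_pre_h hdeg_pre_m subspace_PG Suc)
  then show ?case
    using Suc.hyps unfolding hdeg_def
    by (auto simp: mor.simps(2) intro: subspace_scale[OF subspace_PG] simp del: power_Suc)
qed

text \<open>
  The morphism equation of arity n, the target having zero operations.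
\<close>

definition mor_rel :: "nat \<Rightarrow> bool" where
  "mor_rel n \<longleftrightarrow> (\<forall>xs. length xs = n \<longrightarrow> set xs \<subseteq> T \<longrightarrow> pre_d (mor n) xs = (-1) ^ n *s pre_m (mor (n - 1)) xs)"

lemma mor_rel_1: "mor_rel (Suc 0)"
  by (auto simp: mor_rel_def length_Suc_conv)

lemma pre_d_pre_m_mor:
  assumes "mor_rel n" "length ys = Suc n" "set ys \<subseteq> T"
  shows "pre_d (pre_m (mor n)) ys = 0"
proof -
  have "pre_d (pre_m (mor n)) ys = pre_m (pre_d (mor n)) ys"
    by (rule pre_d_pre_m[OF mlin_mor assms(3)])
  also have "\<dots> = pre_m (\<lambda>zs. (-1) ^ n *s pre_m (mor (n - 1)) zs) ys"
    by (rule pre_m_cong) (use assms in \<open>auto simp: mor_rel_def\<close>)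
  also have "\<dots> = 0"
    using assms(3) by (simp add: pre_scale pre_m_pre_m)
  finally show ?thesis .
qed

lemma pre_d_cocycles:
  assumes "mlin F" "\<And>x. x \<in> set xs \<Longrightarrow> x \<in> T \<and> d x = 0"
  shows "pre_d F xs = 0"
  using assms
proof (induction xs arbitrary: F)
  case (Cons x xs)
  have "pre_d (\<lambda>ys. F (bar x # ys)) xs = 0"
    by (rule Cons.IH[OF mlin_Cons[OF Cons.prems(1)]]) (use Cons.prems(2) in auto)
  then show ?case
    using Cons.prems(2) vs.linear_0[OF mlin_lin_Cons[OF Cons.prems(1)]] by simp
qed simp

text \<open>
  A map that kills boundaries takes the same value on cohomologous tensors of cocycles; P replaces a
  cocycle by the standard representative of its class.
\<close>

lemma pre_m_mor_map_P_cocycles: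
  assumes "mor_rel n" "length xs = Suc n" "\<And>x. x \<in> set xs \<Longrightarrow> x \<in> T \<and> d x = 0"
  shows "pre_m (mor n) (map P xs) = pre_m (mor n) xs"
proof -
  have xs: "set xs \<subseteq> T" using assms by auto
  have "pre_h (pre_d (pre_m (mor n))) xs = pre_h (\<lambda>_. 0) xs"
    by (rule pre_h_cong) (use pre_d_pre_m_mor[OF assms(1)] assms(2) xs in auto)
  moreover have "pre_d (pre_h (pre_m (mor n))) xs = 0"
    by (rule pre_d_cocycles) (use assms mlin_pre_h mlin_pre_m mlin_mor in auto)
  ultimately show ?thesis
    using pre_d_pre_h_homotopy[OF mlin_pre_m[OF mlin_mor] xs, of n] by simp
qed

text \<open>
  The obstruction to the next morphism equation is a multilinear map with \<open>\<phi> \<circ> d = 0\<close>, and the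
  contraction of the tensor power writes it as \<open>\<phi> \<circ> P\<^sup>\<otimes>\<close> plus a map that is precomposed with d.
\<close>

lemma mor_rel_Suc:
  assumes n: "n \<noteq> 0" "mor_rel n"
    and obst: "\<And>xs. length xs = Suc n \<Longrightarrow> set xs \<subseteq> T \<Longrightarrow> pre_m (mor n) (map P xs) = 0"
  shows "mor_rel (Suc n)"
  unfolding mor_rel_def
proof (intro allI impI)
  fix xs :: "'a list"
  assume xs: "length xs = Suc n" "set xs \<subseteq> T"
  have "pre_h (pre_d (pre_m (mor n))) xs = pre_h (\<lambda>_. 0) xs"
    by (rule pre_h_cong) (use pre_d_pre_m_mor[OF n(2)] xs in auto)
  then have "pre_d (pre_h (pre_m (mor n))) xs = pre_m (mor n) xs"
    using pre_d_pre_h_homotopy[OF mlin_pre_m[OF mlin_mor] xs(2), of n] obst[OF xs] by simp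
  then show "pre_d (mor (Suc n)) xs = (-1) ^ Suc n *s pre_m (mor (Suc n - 1)) xs"
    using n by (simp add: mor.simps(2) pre_scale del: power_Suc)
qed


text \<open>
  On homogeneous entries the recursive operators are the signed sums in the definition of
  \<open>A\<^sub>\<infinity>\<close>-morphisms.
\<close>

lemma pre_d_closed_form:
  assumes "mlin F" "list_all2 (\<lambda>p x. x \<in> G p) ds xs"
  shows "pre_d F xs = (\<Sum>r<length xs. (-1) powi sum_list (take r ds) *s
    F (take r xs @ d (xs ! r) # drop (Suc r) xs))"
  using assms
proof (induction xs arbitrary: F ds)
  case (Cons x xs)
  then obtain p ps where ds: "ds = p # ps" "x \<in> G p" "list_all2 (\<lambda>p x. x \<in> G p) ps xs"
    by (auto simp: list_all2_Cons2)
  have F: "F (bar x # ys) = (-1) powi p *s F (x # ys)" for ys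
    using ds(2) by (simp add: bar_hom vs.linear_scale[OF mlin_lin_Cons[OF Cons.prems(1)]])
  have "pre_d (\<lambda>ys. F (bar x # ys)) xs = (-1) powi p *s pre_d (\<lambda>ys. F (x # ys)) xs"
    by (simp add: F pre_scale)
  also have "\<dots> = (\<Sum>r<length xs. (-1) powi sum_list (take (Suc r) ds) *s
      F (take (Suc r) (x # xs) @ d ((x # xs) ! Suc r) # drop (Suc (Suc r)) (x # xs)))"
    by (simp add: Cons.IH[OF mlin_Cons[OF Cons.prems(1)] ds(3)] scale_sum_right ds(1)
        power_int_add)
  finally show ?case
    by (simp add: sum.lessThan_Suc_shift del: sum.lessThan_Suc)
qed simp

lemma pre_m_closed_form:
  "pre_m F xs = (\<Sum>r<length xs - 1. (-1) ^ r *s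
    F (take r xs @ (xs ! r \<cdot> xs ! Suc r) # drop (Suc (Suc r)) xs))"
proof (induction xs arbitrary: F)
  case (Cons x xs)
  show ?case
  proof (cases xs)
    case xs: (Cons y ys)
    show ?thesis
      using Cons.IH[of "\<lambda>ys. F (x # ys)"]
      by (simp add: xs sum.lessThan_Suc_shift sum_negf[symmetric] del: sum.lessThan_Suc)
  qed simp
qed simp


section \<open>Massey products\<close>

definition massey_cochain :: "(nat \<Rightarrow> nat \<Rightarrow> 'a) \<Rightarrow> nat \<Rightarrow> nat \<Rightarrow> 'a" where
  "massey_cochain a i j = (\<Sum>k\<in>{i<..<j}. bar (a i k) \<cdot> a k j)"

lemma sum_triangle_swap:
  fixes f :: "nat \<Rightarrow> nat \<Rightarrow> 'a"
  shows "(\<Sum>l\<in>{i<..<n}. \<Sum>k\<in>{i<..<l}. f k l) = (\<Sum>k\<in>{i<..<n}. \<Sum>l\<in>{k<..<n}. f k l)"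
proof -
  have "(\<Sum>l\<in>{i<..<n}. \<Sum>k\<in>{i<..<l}. f k l)
      = (\<Sum>l\<in>{i<..<n}. \<Sum>k\<in>{k \<in> {i<..<n}. k < l}. f k l)"
    by (intro sum.cong) auto
  also have "\<dots> = (\<Sum>k\<in>{i<..<n}. \<Sum>l\<in>{l \<in> {i<..<n}. k < l}. f k l)"
    by (rule sum.swap_restrict) auto
  also have "\<dots> = (\<Sum>k\<in>{i<..<n}. \<Sum>l\<in>{k<..<n}. f k l)"
    by (intro sum.cong) auto
  finally show ?thesis .
qed

text \<open>
  The function F, extended linearly to the bar construction, at the element W that the system a
  defines: the sum over all subdivisions of \<open>{i..n}\<close>, chosen from the left.  An entry that is
  followed by k others gets bar applied k times; these are the signs of the desuspensions, and with
  them W is a cycle once a solves all the equations.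
\<close>

function chain :: "(nat \<Rightarrow> nat \<Rightarrow> 'a) \<Rightarrow> nat \<Rightarrow> nat \<Rightarrow> ('a list \<Rightarrow> 'a) \<Rightarrow> 'a" where
  "chain a n i F = F [a i n]
     + (\<Sum>l\<in>{i<..<n}. chain a n l (\<lambda>ys. F ((bar ^^ length ys) (a i l) # ys)))"
  by auto
termination
  by (relation "measure (\<lambda>(a, n, i, F). n - i)") auto

declare chain.simps [simp del]

lemma chain_add: "chain a n i (\<lambda>ys. F ys + F' ys) = chain a n i F + chain a n i F'"
proof (induction "n - i" arbitrary: i F F' rule: less_induct)
  case less
  have "(\<Sum>l\<in>{i<..<n}. chain a n l (\<lambda>ys. F ((bar ^^ length ys) (a i l) # ys) + F' ((bar ^^ length ys) (a i l) # ys)))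
      = (\<Sum>l\<in>{i<..<n}. chain a n l (\<lambda>ys. F ((bar ^^ length ys) (a i l) # ys))
          + chain a n l (\<lambda>ys. F' ((bar ^^ length ys) (a i l) # ys)))"
    by (intro sum.cong refl less) auto
  then show ?case
    by (subst (1 2 3) chain.simps) (simp add: sum.distrib)
qed

lemma chain_sum: "finite I \<Longrightarrow> chain a n i (\<lambda>ys. \<Sum>k\<in>I. F k ys) = (\<Sum>k\<in>I. chain a n i (F k))"
proof (induction I rule: finite_induct)
  case empty
  have "chain a n i (\<lambda>_. 0) + chain a n i (\<lambda>_. 0) = chain a n i (\<lambda>_. 0)"
    by (simp add: chain_add[symmetric])
  then show ?case by simp
qed (simp add: chain_add)

lemma T_bar_pow [simp]: "x \<in> T \<Longrightarrow> (bar ^^ k) x \<in> T"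
  by (induction k) auto

lemma lin_bar_pow: "lin (bar ^^ k)"
proof (induction k)
  case 0
  then show ?case using lin_id by (simp add: id_def)
next
  case (Suc k)
  then show ?case using lin_compose[OF lin_bar Suc] by (simp add: comp_def)
qed

text \<open>
  The lists in the sum have one entry for each part of a subdivision, hence at most \<open>n - i\<close>; the
  next lemma singles out the only one of this length.
\<close>

lemma chain_short:
  assumes "i < n" "\<And>k l. i \<le> k \<Longrightarrow> k < l \<Longrightarrow> l \<le> n \<Longrightarrow> a k l \<in> T"
    and "\<And>ys. length ys \<le> n - i \<Longrightarrow> set ys \<subseteq> T \<Longrightarrow> F ys = 0"
  shows "chain a n i F = 0"
  using assms
proof (induction "n - i" arbitrary: i F rule: less_induct)
  case less
  have "F [a i n] = 0"
    by (rule less.prems) (use less.prems(1,2) in auto)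
  moreover have "chain a n l (\<lambda>ys. F ((bar ^^ length ys) (a i l) # ys)) = 0" if "l \<in> {i<..<n}" for l
    by (rule less.hyps) (use that less.prems(2) in \<open>auto intro!: less.prems(3)\<close>)
  ultimately show ?case by (subst chain.simps) simp
qed

lemma chain_top:
  assumes "i < n" "\<And>k l. i \<le> k \<Longrightarrow> k < l \<Longrightarrow> l \<le> n \<Longrightarrow> a k l \<in> T"
    and "\<And>ys. length ys < n - i \<Longrightarrow> set ys \<subseteq> T \<Longrightarrow> F ys = 0"
  shows "chain a n i F = F (map (\<lambda>k. (bar ^^ (n - Suc k)) (a k (Suc k))) [i..<n])"
  using assms
proof (induction "n - i" arbitrary: i F rule: less_induct)
  case less
  show ?case
  proof (cases "n = Suc i")
    case True
    moreover have "{i<..<Suc i} = {}" by auto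
    ultimately show ?thesis by (subst chain.simps) simp
  next
    case False
    then have n: "Suc i < n" using less.prems by simp
    have "F [a i n] = 0"
      by (rule less.prems) (use less.prems(1,2) n in auto)
    moreover have "{i<..<n} = insert (Suc i) {Suc i<..<n}" using n by auto
    moreover have "chain a n l (\<lambda>ys. F ((bar ^^ length ys) (a i l) # ys)) = 0"
      if "l \<in> {Suc i<..<n}" for l
      by (rule chain_short) (use that less.prems(2) in \<open>auto intro!: less.prems(3)\<close>)
    moreover have "chain a n (Suc i) (\<lambda>ys. F ((bar ^^ length ys) (a i (Suc i)) # ys))
      = F (map (\<lambda>k. (bar ^^ (n - Suc k)) (a k (Suc k))) [i..<n])"
      using n
      by (subst less.hyps) (use less.prems(2) in \<open>auto intro!: less.prems(3) simp: upt_conv_Cons[of i]\<close>)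
    ultimately show ?thesis
      by (subst chain.simps) simp
  qed
qed

text \<open>
  The failure of F to be a morphism into a space with zero operations; up to sign it is F composed
  with the differential of the bar construction.
\<close>

definition defect :: "('a list \<Rightarrow> 'a) \<Rightarrow> 'a list \<Rightarrow> 'a" where
  "defect F xs = pre_d F xs - (-1) ^ length xs *s pre_m F xs"

lemma pre_d_cong: "(\<And>ys. length ys = length xs \<Longrightarrow> F ys = F' ys) \<Longrightarrow> pre_d F xs = pre_d F' xs"
proof (induction xs arbitrary: F F')
  case (Cons x xs)
  have "pre_d (\<lambda>ys. F (bar x # ys)) xs = pre_d (\<lambda>ys. F' (bar x # ys)) xs"
    by (rule Cons.IH) (simp add: Cons.prems)
  then show ?case by (simp add: Cons.prems)
qed simp

lemma pre_m_length_cong: "(\<And>ys. Suc (length ys) = length xs \<Longrightarrow> F ys = F' ys) \<Longrightarrow> pre_m F xs = pre_m F' xs"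
proof (induction xs arbitrary: F F')
  case (Cons x xs)
  have "merge_head F x xs = merge_head F' x xs"
    by (cases xs) (simp_all add: Cons.prems)
  moreover have "pre_m (\<lambda>ys. F (x # ys)) xs = pre_m (\<lambda>ys. F' (x # ys)) xs"
    by (rule Cons.IH) (simp add: Cons.prems)
  ultimately show ?case by simp
qed simp

text \<open>
  Splits the boundary of a bar element into the terms that change the first entry, those that only
  concern the others, and the product of the first two.  The number of bars on the first entry has to
  depend on the length of the rest, as it does in \<open>chain\<close>, for the middle part to be again of the
  form defect.
\<close>

lemma defect_Cons:
  fixes b :: 'a
  defines "F' \<equiv> \<lambda>F ys. F ((bar ^^ Suc (length ys)) b # ys)"
  shows "defect F ((bar ^^ length ys) b # ys) = F (d ((bar ^^ length ys) b) # ys) + defect (F' F) ys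
    + (-1) ^ length ys *s merge_head F ((bar ^^ length ys) b) ys"
proof -
  have "pre_d (F' F) ys = pre_d (\<lambda>zs. F (bar ((bar ^^ length ys) b) # zs)) ys"
    by (rule pre_d_cong) (simp add: F'_def)
  moreover have "pre_m (F' F) ys = pre_m (\<lambda>zs. F ((bar ^^ length ys) b # zs)) ys"
    by (rule pre_m_length_cong) (simp add: F'_def flip: funpow.simps(2))
  ultimately show ?thesis
    by (simp add: defect_def scale_right_diff_distrib)
qed

lemma d_bar_pow: "x \<in> T \<Longrightarrow> d ((bar ^^ k) x) = (-1) ^ k *s (bar ^^ k) (d x)"
  by (induction k) (simp_all add: d_bar)

lemma bar_pow_m: "x \<in> T \<Longrightarrow> y \<in> T \<Longrightarrow> (bar ^^ k) (x \<cdot> y) = (bar ^^ k) x \<cdot> (bar ^^ k) y"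
  by (induction k) (simp_all add: bar_m)

text \<open>
  The element W is a cycle up to the terms of its one-part subdivision.  The differential of
  \<open>a i l\<close> is a sum of products \<open>bar (a i k) \<cdot> a k l\<close>, and the same products arise, with the
  opposite sign, when the first two entries of the refined subdivision through k are multiplied.
\<close>

lemma chain_defect:
  assumes "i < n" "\<And>k l. i \<le> k \<Longrightarrow> k < l \<Longrightarrow> l \<le> n \<Longrightarrow> a k l \<in> T"
    and "\<And>k l. i \<le> k \<Longrightarrow> k < l \<Longrightarrow> l \<le> n \<Longrightarrow> (k, l) \<noteq> (i, n) \<Longrightarrow> d (a k l) = massey_cochain a k l"
    and "mlin F"
  shows "chain a n i (defect F) = F [d (a i n)] - F [massey_cochain a i n]"
  using assms
proof (induction "n - i" arbitrary: i F rule: less_induct)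
  case less
  note aT = less.prems(2) and da = less.prems(3) and F = mlin_lin_Cons[OF less.prems(4)]
  define X where "X k l = chain a n l (\<lambda>ys. (-1) ^ length ys *s
    F ((bar ^^ Suc (length ys)) (a i k) \<cdot> (bar ^^ length ys) (a k l) # ys))" for k l
  have step: "chain a n l (\<lambda>ys. defect F ((bar ^^ length ys) (a i l) # ys))
    = (\<Sum>k\<in>{i<..<l}. X k l) - F [bar (a i l) \<cdot> a l n] - (\<Sum>k\<in>{l<..<n}. X l k)"
    if l: "l \<in> {i<..<n}" for l
  proof -
    \<comment> \<open>The part of the boundary that leaves the first entry alone vanishes by induction, applied to
      the sum over the subdivisions that start at l.\<close>
    define F' where "F' ys = F ((bar ^^ Suc (length ys)) (a i l) # ys)" for ys
    have il: "a i l \<in> T" using aT l by simp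
    have lin_F': "lin (\<lambda>x. F' (us @ x # vs))" for us vs
      using mlin_lin[OF less.prems(4), of "(bar ^^ Suc (length us + Suc (length vs))) (a i l) # us" vs]
      by (simp add: F'_def)
    have IH: "chain a n l (defect F') = 0"
    proof -
      have "chain a n l (defect F') = F' [d (a l n)] - F' [massey_cochain a l n]"
        by (rule less.hyps) (use l aT da lin_F' in \<open>auto simp: mlin_def\<close>)
      then show ?thesis using l da by simp
    qed
    have 1: "F (d ((bar ^^ length ys) (a i l)) # ys) = (\<Sum>k\<in>{i<..<l}. (-1) ^ length ys *s
      F ((bar ^^ Suc (length ys)) (a i k) \<cdot> (bar ^^ length ys) (a k l) # ys))" for ys
    proof -
      have "d ((bar ^^ length ys) (a i l)) = (-1) ^ length ys *s (bar ^^ length ys) (massey_cochain a i l)"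
        using il l da by (simp add: d_bar_pow)
      also have "(bar ^^ length ys) (massey_cochain a i l)
        = (\<Sum>k\<in>{i<..<l}. (bar ^^ Suc (length ys)) (a i k) \<cdot> (bar ^^ length ys) (a k l))"
        unfolding massey_cochain_def vs.linear_sum[OF lin_bar_pow]
        using l aT by (intro sum.cong) (auto simp: bar_pow_m funpow_swap1)
      finally show ?thesis
        by (simp add: vs.linear_scale[OF F] vs.linear_sum[OF F] scale_sum_right)
    qed
    have 2: "chain a n l (\<lambda>ys. (-1) ^ length ys *s merge_head F ((bar ^^ length ys) (a i l)) ys)
      = - F [bar (a i l) \<cdot> a l n] - (\<Sum>k\<in>{l<..<n}. X l k)"
    proof -
      have neg: "chain a n k (\<lambda>ys. - H ys) = - chain a n k H" for k H
        using chain_add[of a n k H "\<lambda>ys. - H ys"] chain_sum[of "{}" a n k]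
        by (simp add: eq_neg_iff_add_eq_0 add.commute)
      show ?thesis
        by (subst chain.simps) (simp add: X_def neg sum_negf)
    qed
    have "chain a n l (\<lambda>ys. defect F ((bar ^^ length ys) (a i l) # ys))
      = chain a n l (\<lambda>ys. F (d ((bar ^^ length ys) (a i l)) # ys)) + chain a n l (defect F')
        + chain a n l (\<lambda>ys. (-1) ^ length ys *s merge_head F ((bar ^^ length ys) (a i l)) ys)"
      unfolding defect_Cons F'_def by (simp only: chain_add)
    also have "chain a n l (\<lambda>ys. F (d ((bar ^^ length ys) (a i l)) # ys)) = (\<Sum>k\<in>{i<..<l}. X k l)"
      unfolding 1 X_def by (simp only: chain_sum finite_greaterThanLessThan)
    finally show ?thesis
      by (simp add: 2 IH)
  qed
  have "chain a n i (defect F) = F [d (a i n)] + (\<Sum>l\<in>{i<..<n}.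
      (\<Sum>k\<in>{i<..<l}. X k l) - F [bar (a i l) \<cdot> a l n] - (\<Sum>k\<in>{l<..<n}. X l k))"
    using step by (subst chain.simps) (simp add: defect_def vs.linear_0)
  also have "\<dots> = F [d (a i n)] - (\<Sum>l\<in>{i<..<n}. F [bar (a i l) \<cdot> a l n])"
    using sum_triangle_swap[of X i n] by (simp add: sum_subtractf)
  also have "(\<Sum>l\<in>{i<..<n}. F [bar (a i l) \<cdot> a l n]) = F [massey_cochain a i n]"
    by (simp add: massey_cochain_def vs.linear_sum[OF F])
  finally show ?case .
qed


text \<open>
  All components up to N as one function, extended by zero; its defect vanishes up to length N, and
  at length \<open>N + 1\<close> it is the obstruction to the next component.
\<close>

definition mor_upto :: "nat \<Rightarrow> 'a list \<Rightarrow> 'a" where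
  "mor_upto N xs = (if length xs \<le> N then mor (length xs) xs else 0)"

lemma mlin_mor_upto: "mlin (mor_upto N)"
  unfolding mlin_def
proof (intro allI)
  fix us vs
  show "lin (\<lambda>x. mor_upto N (us @ x # vs))"
    using mlin_lin[OF mlin_mor, of "length us + Suc (length vs)" us vs]
    by (cases "length us + Suc (length vs) \<le> N") (simp_all add: mor_upto_def vs.linear_zero)
qed

lemma defect_mor_upto:
  assumes "\<And>k. 1 \<le> k \<Longrightarrow> k \<le> N \<Longrightarrow> mor_rel k" "length xs \<le> N" "set xs \<subseteq> T"
  shows "defect (mor_upto N) xs = 0"
proof (cases xs)
  case (Cons x ys)
  have "pre_d (mor_upto N) xs = pre_d (mor (length xs)) xs"
    by (rule pre_d_cong) (use assms(2) in \<open>simp add: mor_upto_def\<close>)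
  moreover have "pre_m (mor_upto N) xs = pre_m (mor (length xs - 1)) xs"
    by (rule pre_m_length_cong) (use assms(2) Cons in \<open>auto simp: mor_upto_def\<close>)
  moreover have "mor_rel (length xs)"
    by (rule assms(1)) (use assms(2) Cons in auto)
  ultimately show ?thesis
    using assms(3) by (simp add: defect_def mor_rel_def)
qed (simp add: defect_def)

lemma defect_mor_upto_top:
  assumes "length xs = Suc N"
  shows "defect (mor_upto N) xs = (-1) ^ N *s pre_m (mor N) xs"
proof -
  have "pre_d (mor_upto N) xs = pre_d (\<lambda>_. 0) xs"
    by (rule pre_d_cong) (use assms in \<open>simp add: mor_upto_def\<close>)
  moreover have "pre_m (mor_upto N) xs = pre_m (mor N) xs"
    by (rule pre_m_length_cong) (use assms in \<open>auto simp: mor_upto_def\<close>)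
  ultimately show ?thesis using assms by (simp add: defect_def)
qed

text \<open>
  The components that already exist detect that a Massey cochain of at most N classes is exact: both
  of its evaluations on W have to agree, and one of them is zero.
\<close>

lemma P_massey_cochain_eq_0:
  assumes "\<And>k. 1 \<le> k \<Longrightarrow> k \<le> N \<Longrightarrow> mor_rel k" "1 \<le> N" "i < n" "n - i \<le> N"
    and "\<And>k l. i \<le> k \<Longrightarrow> k < l \<Longrightarrow> l \<le> n \<Longrightarrow> a k l \<in> T"
    and "\<And>k l. i \<le> k \<Longrightarrow> k < l \<Longrightarrow> l \<le> n \<Longrightarrow> (k, l) \<noteq> (i, n) \<Longrightarrow> d (a k l) = massey_cochain a k l"
  shows "P (massey_cochain a i n) = 0"
proof -
  have "chain a n i (defect (mor_upto N)) = 0"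
    by (rule chain_short) (use assms in \<open>auto intro!: defect_mor_upto\<close>)
  moreover have "chain a n i (defect (mor_upto N)) = mor_upto N [d (a i n)] - mor_upto N [massey_cochain a i n]"
    by (rule chain_defect) (use assms mlin_mor_upto in auto)
  ultimately show ?thesis
    using assms by (simp add: mor_upto_def)
qed

text \<open>
  For one class more, the list of single entries is the only one on which the defect can be nonzero,
  and there it is the obstruction.  The right-hand side may depend on the system, but the left-hand
  side only depends on the classes.
\<close>

lemma obstruction_eq_massey:
  assumes "\<And>k. 1 \<le> k \<Longrightarrow> k \<le> N \<Longrightarrow> mor_rel k" "1 \<le> N" "n = i + Suc N"
    and "\<And>k l. i \<le> k \<Longrightarrow> k < l \<Longrightarrow> l \<le> n \<Longrightarrow> a k l \<in> T"
    and "\<And>k l. i \<le> k \<Longrightarrow> k < l \<Longrightarrow> l \<le> n \<Longrightarrow> (k, l) \<noteq> (i, n) \<Longrightarrow> d (a k l) = massey_cochain a k l"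
  shows "(-1) ^ N *s pre_m (mor N) (map (\<lambda>k. (bar ^^ (n - Suc k)) (a k (Suc k))) [i..<n])
    = - P (massey_cochain a i n)"
proof -
  have "chain a n i (defect (mor_upto N)) = defect (mor_upto N) (map (\<lambda>k. (bar ^^ (n - Suc k)) (a k (Suc k))) [i..<n])"
    by (rule chain_top) (use assms in \<open>auto intro!: defect_mor_upto\<close>)
  moreover have "chain a n i (defect (mor_upto N)) = mor_upto N [d (a i n)] - mor_upto N [massey_cochain a i n]"
    by (rule chain_defect) (use assms mlin_mor_upto in auto)
  ultimately show ?thesis
    using assms by (simp add: mor_upto_def defect_mor_upto_top)
qed

text \<open>
  Expanding the differential gives every triple product \<open>a i l \<cdot> bar (a l k) \<cdot> a k j\<close> twice, with
  opposite signs.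
\<close>

lemma d_massey_cochain:
  assumes "i < j" "\<And>k l. i \<le> k \<Longrightarrow> k < l \<Longrightarrow> l \<le> j \<Longrightarrow> (k, l) \<noteq> (i, j) \<Longrightarrow> a k l \<in> T \<and> d (a k l) = massey_cochain a k l"
  shows "d (massey_cochain a i j) = 0"
proof -
  have aT: "a k l \<in> T" "d (a k l) = massey_cochain a k l" if "i \<le> k" "k < l" "l \<le> j" "(k, l) \<noteq> (i, j)" for k l
    using assms(2)[OF that] by auto
  have "d (bar (a i k) \<cdot> a k j) = (\<Sum>l\<in>{k<..<j}. a i k \<cdot> bar (a k l) \<cdot> a l j)
      - (\<Sum>l\<in>{i<..<k}. a i l \<cdot> bar (a l k) \<cdot> a k j)" if k: "k \<in> {i<..<j}" for k
  proof -
    have "d (bar (a i k) \<cdot> a k j) = a i k \<cdot> massey_cochain a k j - bar (massey_cochain a i k) \<cdot> a k j"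
      using k by (simp add: leibniz aT d_bar)
    moreover have "a i k \<cdot> massey_cochain a k j = (\<Sum>l\<in>{k<..<j}. a i k \<cdot> bar (a k l) \<cdot> a l j)"
      unfolding massey_cochain_def m_sum_right using k by (intro sum.cong) (auto simp: aT assoc)
    moreover have "bar (massey_cochain a i k) \<cdot> a k j = (\<Sum>l\<in>{i<..<k}. a i l \<cdot> bar (a l k) \<cdot> a k j)"
      unfolding massey_cochain_def ops_sum m_sum_left using k by (intro sum.cong) (auto simp: aT bar_m)
    ultimately show ?thesis by simp
  qed
  then have "d (massey_cochain a i j) = (\<Sum>k\<in>{i<..<j}. (\<Sum>l\<in>{k<..<j}. a i k \<cdot> bar (a k l) \<cdot> a l j)
      - (\<Sum>l\<in>{i<..<k}. a i l \<cdot> bar (a l k) \<cdot> a k j))"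
    by (simp add: massey_cochain_def ops_sum)
  also have "\<dots> = 0"
    using sum_triangle_swap[of "\<lambda>l k. a i l \<cdot> bar (a l k) \<cdot> a k j" i j]
    by (simp add: sum_subtractf)
  finally show ?thesis .
qed

text \<open>
  The defining system that solves all equations with the contracting homotopy h.
\<close>

function transfer_sys :: "(nat \<Rightarrow> 'a) \<Rightarrow> nat \<Rightarrow> nat \<Rightarrow> 'a" where
  "transfer_sys z i j = (if j = Suc i then z i else h (\<Sum>k\<in>{i<..<j}. bar (transfer_sys z i k) \<cdot> transfer_sys z k j))"
  by auto
termination
  by (relation "measure (\<lambda>(z, i, j). j - i)") auto

declare transfer_sys.simps [simp del]

lemma massey_cochain_G:
  assumes "\<And>k. k \<in> {i<..<j} \<Longrightarrow> a i k \<in> G (e i k) \<and> a k j \<in> G (e k j) \<and> e i k + e k j = q"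
  shows "massey_cochain a i j \<in> G q"
  unfolding massey_cochain_def by (rule subspace_sum[OF subspace_G]) (use assms m_G bar_G in metis)

lemma transfer_sys_G:
  assumes "i < j" "\<And>k. i \<le> k \<Longrightarrow> k < j \<Longrightarrow> z k \<in> G (p k)"
  shows "transfer_sys z i j \<in> G (sum p {i..<j} - int (j - Suc i))"
  using assms
proof (induction "j - i" arbitrary: i j rule: less_induct)
  case less
  show ?case
  proof (cases "j = Suc i")
    case True
    then show ?thesis using less.prems by (simp add: transfer_sys.simps)
  next
    case False
    have "massey_cochain (transfer_sys z) i j \<in> G (sum p {i..<j} - int (j - Suc (Suc i)))"
    proof (rule massey_cochain_G[where e = "\<lambda>i j. sum p {i..<j} - int (j - Suc i)"], intro conjI)
      fix k assume k: "k \<in> {i<..<j}"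
      show "transfer_sys z i k \<in> G (sum p {i..<k} - int (k - Suc i))"
        "transfer_sys z k j \<in> G (sum p {k..<j} - int (j - Suc k))"
        by (rule less.hyps; use k less.prems in auto)+
      have "sum p {i..<j} = sum p {i..<k} + sum p {k..<j}"
        using k by (simp add: sum.atLeastLessThan_concat)
      then show "sum p {i..<k} - int (k - Suc i) + (sum p {k..<j} - int (j - Suc k))
        = sum p {i..<j} - int (j - Suc (Suc i))"
        using k by auto
    qed
    from h_G[OF this] show ?thesis
      using False less.prems(1) by (subst transfer_sys.simps) (simp add: massey_cochain_def algebra_simps of_nat_diff)
  qed
qed

text \<open>
  By induction on \<open>j - i\<close> the Massey cochain of (i, j) is closed, and it is killed by P since the
  obstructions of arity at most N vanish; so \<open>1 = P + d h + h d\<close> shows that h solves the equation.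
\<close>

lemma transfer_sys_d:
  assumes "\<And>k. 1 \<le> k \<Longrightarrow> k \<le> N \<Longrightarrow> mor_rel k"
    and "\<And>k. i \<le> k \<Longrightarrow> k < j \<Longrightarrow> z k \<in> G (p k) \<and> d (z k) = 0"
    and "i < j" "j - i \<le> N"
  shows "d (transfer_sys z i j) = massey_cochain (transfer_sys z) i j"
  using assms(2-)
proof (induction "j - i" arbitrary: i j rule: less_induct)
  case less
  show ?case
  proof (cases "j = Suc i")
    case True
    then have "{i<..<j} = {}" by auto
    then show ?thesis using less.prems(1)[of i] True by (simp add: transfer_sys.simps massey_cochain_def)
  next
    case False
    have T: "transfer_sys z k l \<in> T" if "i \<le> k" "k < l" "l \<le> j" for k l
      by (rule T_G[OF transfer_sys_G[where p = p]]) (use that less.prems(1) in auto)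
    have d: "d (transfer_sys z k l) = massey_cochain (transfer_sys z) k l" if "i \<le> k" "k < l" "l \<le> j" "(k, l) \<noteq> (i, j)" for k l
      by (rule less.hyps) (use that less.prems in auto)
    have "P (massey_cochain (transfer_sys z) i j) = 0"
      by (rule P_massey_cochain_eq_0[OF assms(1)]) (use T d less.prems in auto)
    moreover have "d (massey_cochain (transfer_sys z) i j) = 0"
      by (rule d_massey_cochain) (use T d less.prems in auto)
    ultimately have "d (h (massey_cochain (transfer_sys z) i j)) = massey_cochain (transfer_sys z) i j"
      by (simp add: P_def)
    then show ?thesis
      using False by (simp add: transfer_sys.simps[of z i j] massey_cochain_def)
  qed
qed

text \<open>
  Defining systems for the classes of \<open>z 0, \<dots>, z (n - 1)\<close>.
\<close>

definition massey_sys :: "(nat \<Rightarrow> 'a) \<Rightarrow> nat \<Rightarrow> (nat \<Rightarrow> nat \<Rightarrow> int) \<Rightarrow> (nat \<Rightarrow> nat \<Rightarrow> 'a) \<Rightarrow> bool" where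
  "massey_sys z n e a \<longleftrightarrow>
     (\<forall>i j. i < j \<and> j \<le> n \<and> (i, j) \<noteq> (0, n) \<longrightarrow> a i j \<in> G (e i j) \<and> d (a i j) = massey_cochain a i j) \<and>
     (\<forall>k<n. a k (Suc k) - z k \<in> d ` T)"

end

text \<open>
  For n = 2 the hypothesis says that the product on cohomology is zero, for larger n that the Massey
  n-products vanish.
\<close>

locale massey_trivial_dga = contracted_dga +
  assumes massey_trivial:
    "\<lbrakk>2 \<le> n; \<And>k. k < n \<Longrightarrow> z k \<in> G (p k) \<and> d (z k) = 0; massey_sys z n e a\<rbrakk>
      \<Longrightarrow> \<exists>e a. massey_sys z n e a \<and> massey_cochain a 0 n \<in> d ` T"
begin

text \<open>
  The obstruction is computed with a system whose Massey cochain is exact; that some system exists at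
  all, which the hypothesis presupposes, comes from \<open>transfer_sys\<close>.
\<close>

lemma pre_m_mor_map_P_homogeneous:
  assumes mor_rel: "\<And>k. 1 \<le> k \<Longrightarrow> k \<le> N \<Longrightarrow> mor_rel k" and N: "1 \<le> N"
    and xs: "length xs = Suc N" "set xs \<subseteq> (\<Union>p. G p)"
  shows "pre_m (mor N) (map P xs) = 0"
proof -
  define n where "n = Suc N"
  \<comment> \<open>The bars cancel those that the chain of a system puts on its single entries.\<close>
  define z where "z k = (bar ^^ (n - Suc k)) (P (xs ! k))" for k
  have bar_pow_G: "(bar ^^ k) x \<in> G p" if "x \<in> G p" for k x p
    using that by (induction k) (auto intro: bar_G)
  have "\<exists>p. xs ! k \<in> G p" if "k < n" for k
    using xs nth_mem[of k xs] that unfolding n_def by fastforce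
  then obtain p where p: "k < n \<Longrightarrow> xs ! k \<in> G (p k)" for k
    by metis
  have z: "z k \<in> G (p k)" "d (z k) = 0" if "k < n" for k
    using p[OF that] T_G[OF p[OF that]] by (auto simp: z_def d_bar_pow vs.linear_0[OF lin_bar_pow] intro: bar_pow_G P_G)
  have "massey_sys z n (\<lambda>i j. sum p {i..<j} - int (j - Suc i)) (transfer_sys z)"
    unfolding massey_sys_def
  proof (intro conjI allI impI)
    fix i j assume ij: "i < j \<and> j \<le> n \<and> (i, j) \<noteq> (0, n)"
    show "transfer_sys z i j \<in> G (sum p {i..<j} - int (j - Suc i))"
      by (rule transfer_sys_G) (use ij z in auto)
    show "d (transfer_sys z i j) = massey_cochain (transfer_sys z) i j"
      by (rule transfer_sys_d[OF mor_rel, where p = p]) (use ij z in \<open>auto simp: n_def\<close>)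
  next
    fix k
    have "0 \<in> d ` T" by (rule image_eqI[of _ _ 0]) auto
    then show "transfer_sys z k (Suc k) - z k \<in> d ` T" by (simp add: transfer_sys.simps)
  qed
  then have "\<exists>e a. massey_sys z n e a \<and> massey_cochain a 0 n \<in> d ` T"
    by (rule massey_trivial[where p = p, rotated -1]) (use z N in \<open>auto simp: n_def\<close>)
  then obtain e a where a: "massey_sys z n e a" and "massey_cochain a 0 n \<in> d ` T"
    by blast
  then have P_massey_cochain: "P (massey_cochain a 0 n) = 0" by auto
  \<comment> \<open>A defining system has no entry (0, n), whose value in a is arbitrary.\<close>
  define a' where "a' = (\<lambda>i j. if (i, j) = (0, n) then 0 else a i j)"
  have massey_cochain_eq: "massey_cochain a' i j = massey_cochain a i j" if "i < j" "j \<le> n" for i j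
    unfolding massey_cochain_def by (rule sum.cong) (use that in \<open>auto simp: a'_def\<close>)
  have a'T: "a' i j \<in> T" if "i < j" "j \<le> n" for i j
    using a that by (auto simp: massey_sys_def a'_def intro: T_G)
  define L where "L = map (\<lambda>k. (bar ^^ (n - Suc k)) (a' k (Suc k))) [0..<n]"
  have "(-1) ^ N *s pre_m (mor N) L = - P (massey_cochain a' 0 n)"
    unfolding L_def
    by (rule obstruction_eq_massey[OF mor_rel N])
      (use a a'T in \<open>auto simp: n_def massey_sys_def massey_cochain_eq[unfolded n_def]\<close>, auto simp: a'_def n_def)
  then have L: "pre_m (mor N) L = 0"
    using P_massey_cochain massey_cochain_eq[of 0 n] by (simp add: n_def)
  have bar_pow_P: "P ((bar ^^ k) x) = (bar ^^ k) (P x)" if "x \<in> T" for k x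
    using that by (induction k) (simp_all add: bar_P[symmetric])
  have bar_pow_bar_pow: "(bar ^^ k) ((bar ^^ k) x) = x" if "x \<in> T" for k x
    using that by (induction k) (simp_all add: funpow_swap1)
  have "map P L = map P xs"
  proof (rule nth_equalityI)
    fix k assume "k < length (map P L)"
    then have k: "k < n" by (simp add: L_def)
    have xk: "xs ! k \<in> T" by (rule T_G[OF p[OF k]])
    obtain y where y: "y \<in> T" "a k (Suc k) - z k = d y"
      using a k by (auto simp: massey_sys_def)
    have ak: "a' k (Suc k) = a k (Suc k)"
      using N by (auto simp: a'_def n_def)
    have "P (a k (Suc k)) = P (z k + d y)"
      using y(2) by (simp add: algebra_simps)
    also have "\<dots> = z k"
      using y(1) xk by (simp add: z_def bar_pow_P P_P)
    finally have "P ((bar ^^ (n - Suc k)) (a' k (Suc k))) = (bar ^^ (n - Suc k)) (z k)"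
      using a'T[of k "Suc k"] k ak by (simp add: bar_pow_P)
    then show "map P L ! k = map P xs ! k"
      using k xk xs by (simp add: L_def z_def bar_pow_bar_pow n_def del: upt_Suc)
  qed (simp add: L_def n_def xs)
  moreover have "pre_m (mor N) (map P L) = pre_m (mor N) L"
  proof (rule pre_m_mor_map_P_cocycles)
    fix x assume "x \<in> set L"
    then obtain k where k: "k < n" "x = (bar ^^ (n - Suc k)) (a' k (Suc k))"
      by (auto simp: L_def)
    have "a' k (Suc k) = a k (Suc k)" "(k, Suc k) \<noteq> (0, n)"
      using N by (auto simp: a'_def n_def)
    moreover have "{k<..<Suc k} = {}" by auto
    ultimately have "d (a' k (Suc k)) = 0"
      using a k by (auto simp: massey_sys_def massey_cochain_def)
    then show "x \<in> T \<and> d x = 0"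
      using k a'T[of k "Suc k"] by (simp add: d_bar_pow vs.linear_0[OF lin_bar_pow])
  qed (use mor_rel N in \<open>auto simp: L_def n_def\<close>)
  ultimately show ?thesis using L by simp
qed

lemma mlin_map_P: "mlin F \<Longrightarrow> mlin (\<lambda>xs. F (map P xs))"
  unfolding mlin_def
proof (intro allI)
  fix us vs
  assume "\<forall>us vs. lin (\<lambda>x. F (us @ x # vs))"
  then have "lin (\<lambda>x. F (map P us @ x # map P vs))" by blast
  from lin_compose[OF this lin_P] show "lin (\<lambda>x. F (map P (us @ x # vs)))" by simp
qed

theorem mor_rel_all: "1 \<le> n \<Longrightarrow> mor_rel n"
proof (induction n rule: less_induct)
  case (less n)
  then obtain N where n: "n = Suc N" by (cases n) auto
  show ?case
  proof (cases "N = 0")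
    case True
    then show ?thesis by (simp add: n mor_rel_1)
  next
    case False
    have "pre_m (mor N) (map P xs) = 0" if "length xs = Suc N" "set xs \<subseteq> T" for xs
      by (rule mlin_vanish[OF mlin_map_P[OF mlin_pre_m[OF mlin_mor]] that(2)])
        (rule pre_m_mor_map_P_homogeneous; use less False that n in auto)
    then show ?thesis
      unfolding n using False less by (intro mor_rel_Suc) (auto simp: n)
  qed
qed


end


section \<open>Existence of a contraction\<close>

context vector_space
begin

lemma
  assumes dir: "\<And>I x. finite I \<Longrightarrow> (\<And>p. p \<in> I \<Longrightarrow> x p \<in> S p) \<Longrightarrow> (\<Sum>p\<in>I. x p) = 0 \<Longrightarrow> \<forall>p\<in>I. x p = 0"
    and sub: "\<And>p. subspace (S p)" and E: "\<And>p. E p \<subseteq> S p" "\<And>p. independent (E p)"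
  shows direct_sum_basis_degree_unique: "\<And>p q. v \<in> E p \<Longrightarrow> v \<in> E q \<Longrightarrow> p = q"
    and independent_UN_direct_sum: "independent (\<Union>p. E p)"
proof -
  show *: "p = q" if v: "v \<in> E p" "v \<in> E q" for p q v
  proof (rule ccontr)
    assume "p \<noteq> q"
    have "\<forall>r\<in>{p, q}. (if r = p then v else - v) = 0"
    proof (rule dir)
      show "(if r = p then v else - v) \<in> S r" if "r \<in> {p, q}" for r
        using that v E(1)[of p] E(1)[of q] subspace_neg[OF sub[of q], of v] by auto
      show "(\<Sum>r\<in>{p, q}. if r = p then v else - v) = 0"
        using \<open>p \<noteq> q\<close> by simp
    qed simp
    then have "v = 0" by simp
    then show False using v(1) E(2)[of p] dependent_zero by simp
  qed
  show "independent (\<Union>p. E p)"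
    unfolding independent_explicit_module
  proof (intro allI impI)
    fix t u v
    assume t: "finite t" "t \<subseteq> (\<Union>p. E p)" "(\<Sum>v\<in>t. scale (u v) v) = 0" "v \<in> t"
    then have "\<forall>w\<in>t. \<exists>p. w \<in> E p" by blast
    from bchoice[OF this] obtain g where g: "\<And>w. w \<in> t \<Longrightarrow> w \<in> E (g w)"
      by blast
    have "\<forall>p\<in>g ` t. (\<Sum>w\<in>{w. w \<in> t \<and> g w = p}. scale (u w) w) = 0"
    proof (rule dir)
      show "(\<Sum>w\<in>{w. w \<in> t \<and> g w = p}. scale (u w) w) \<in> S p" for p
      proof (rule subspace_sum[OF sub])
        fix w assume "w \<in> {w. w \<in> t \<and> g w = p}"
        then have "w \<in> S p" using g[of w] E(1)[of p] by auto
        then show "scale (u w) w \<in> S p" by (rule subspace_scale[OF sub])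
      qed
      show "(\<Sum>p\<in>g ` t. \<Sum>w\<in>{w. w \<in> t \<and> g w = p}. scale (u w) w) = 0"
        using sum.image_gen[OF t(1), of "\<lambda>w. scale (u w) w" g] t(3) by simp
    qed (use t in simp)
    then have "(\<Sum>w\<in>{w. w \<in> t \<and> g w = g v}. scale (u w) w) = 0" using t(4) by blast
    moreover have "{w. w \<in> t \<and> g w = g v} \<subseteq> E (g v)"
    proof
      fix w assume "w \<in> {w. w \<in> t \<and> g w = g v}"
      then show "w \<in> E (g v)" using g[of w] by simp
    qed
    ultimately show "u v = 0"
      using t independentD[OF E(2)[of "g v"], of "{w. w \<in> t \<and> g w = g v}" u v] by simp
  qed
qed

end

lemma multilinear_deg_add:
  assumes "multilinear_deg A B n p g" "length us + Suc (length vs) = n"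
    and "set us \<subseteq> total_space A" "set vs \<subseteq> total_space A" "x \<in> total_space A" "y \<in> total_space A"
  shows "g (us @ (x + y) # vs) = g (us @ x # vs) + g (us @ y # vs)"
  using assms(1)[unfolded multilinear_deg_def, THEN conjunct1, rule_format,
      of "us @ x # vs" "length us" x y] assms(2-)
  by simp

lemma multilinear_deg_scale:
  assumes "multilinear_deg A B n p g" "length us + Suc (length vs) = n"
    and "set us \<subseteq> total_space A" "set vs \<subseteq> total_space A" "x \<in> total_space A"
  shows "g (us @ scl A c x # vs) = scl B c (g (us @ x # vs))"
  using assms(1)[unfolded multilinear_deg_def, THEN conjunct2, THEN conjunct1, rule_format,
      of "us @ x # vs" "length us" x c] assms(2-)
  by simp

text \<open>
  In degree p, a basis of the coboundaries is extended to a basis of the whole part.  The homotopy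
  sends the basis elements of the coboundaries to preimages under d and the other ones to 0.  The maps
  are extended linearly to the whole type through a projection onto the graded space.
\<close>

lemma contraction_exists:
  fixes A :: "('k::field, 'a::ab_group_add, 'm) ainf_scheme"
  assumes A: "dg_algebra A"
  obtains d bar h m where "contracted_dga (scl A) (part A) d bar h m"
    and "\<And>x. x \<in> total_space A \<Longrightarrow> d x = diff A x"
    and "\<And>x y. x \<in> total_space A \<Longrightarrow> y \<in> total_space A \<Longrightarrow> m x y = prd A x y"
proof -
  have gr: "graded_space A"
    and ml: "\<And>n. 1 \<le> n \<Longrightarrow> multilinear_deg A A n (2 - int n) (mlt A n)"
    using A by (auto simp: dg_algebra_def A_inf_algebra_def)
  interpret vector_space "scl A" using gr by (simp add: graded_space_def)
  interpret vs: vector_space_pair "scl A" "scl A" ..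
  let ?T = "total_space A"
  have sub: "subspace (part A p)" for p
    using gr by (simp add: graded_space_def)
  have dir: "\<forall>p\<in>I. x p = 0" if "finite I" "\<And>p. p \<in> I \<Longrightarrow> x p \<in> part A p" "(\<Sum>p\<in>I. x p) = 0" for I x
    using gr that unfolding graded_space_def by blast
  have tot: "x \<in> ?T" if "x \<in> part A p" for x p
    using that by (auto simp: total_space_def intro: span_base)
  note rules = dg_algebra_rules[OF A]

  obtain B where B: "B \<subseteq> ?T" "independent B" "?T \<subseteq> span B"
    by (rule basis_exists[of ?T])
  obtain pr where pr: "Vector_Spaces.linear (scl A) (scl A) pr" "\<forall>x\<in>B. pr x = x"
    "range pr = span ((\<lambda>x. x) ` B)"
    using vs.linear_independent_extend_subspace[OF B(2), of "\<lambda>x. x"] by blast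
  have "span B \<subseteq> ?T"
    by (rule span_minimal[OF B(1)]) (simp add: total_space_def)
  with B(3) have span_B: "span B = ?T" by (rule equalityI[rotated])
  have pr_T: "pr x \<in> ?T" for x
    using pr(3) span_B rangeI[of pr x] by simp
  have pr_id: "pr x = x" if "x \<in> ?T" for x
    by (rule vs.linear_eq_on_span[OF pr(1) module_hom_ident, of B]) (use pr(2) B(3) that in blast)+
  note pr_add = vs.linear_add[OF pr(1)] and pr_scale = vs.linear_scale[OF pr(1)]

  define d where "d x = diff A (pr x)" for x
  define m where "m x y = prd A (pr x) (pr y)" for x y
  have lin_d: "Vector_Spaces.linear (scl A) (scl A) d"
    using multilinear_deg_add[OF ml[of 1], of "[]" "[]"] multilinear_deg_scale[OF ml[of 1], of "[]" "[]"]
    by (simp add: Vector_Spaces.linear_iff vector_space_axioms d_def diff_def pr_add pr_scale pr_T)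
  have lin_m: "Vector_Spaces.linear (scl A) (scl A) (\<lambda>x. m x y)"
    "Vector_Spaces.linear (scl A) (scl A) (\<lambda>y. m x y)" for x y
    using multilinear_deg_add[OF ml[of 2], of "[]" "[pr y]"] multilinear_deg_add[OF ml[of 2], of "[pr x]" "[]"]
      multilinear_deg_scale[OF ml[of 2], of "[]" "[pr y]"] multilinear_deg_scale[OF ml[of 2], of "[pr x]" "[]"]
    by (simp_all add: Vector_Spaces.linear_iff vector_space_axioms m_def prd_def pr_add pr_scale pr_T)
  have d_eq: "d x = diff A x" if "x \<in> part A p" for x p
    using that by (simp add: d_def pr_id tot)
  have m_eq: "m x y = prd A x y" if "x \<in> part A p" "y \<in> part A q" for x y p q
    using that by (simp add: m_def pr_id tot)
  have d_G: "d x \<in> part A (p + 1)" if "x \<in> part A p" for x p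
    using that rules(1) by (simp add: d_eq)
  have m_G: "m x y \<in> part A (p + q)" if "x \<in> part A p" "y \<in> part A q" for x y p q
    using that rules(2) by (simp add: m_eq)
  have dd: "d (d x) = 0" if "x \<in> part A p" for x p
    using rules(3)[OF that that that] d_eq[OF d_G[OF that]] d_eq[OF that] by simp

  have "\<exists>D. D \<subseteq> d ` part A (p - 1) \<and> independent D \<and> d ` part A (p - 1) \<subseteq> span D" for p
    by (rule basis_exists[of "d ` part A (p - 1)"]) (intro exI conjI)
  then obtain D where D: "\<And>p. D p \<subseteq> d ` part A (p - 1)" "\<And>p. independent (D p)"
    "\<And>p. d ` part A (p - 1) \<subseteq> span (D p)"
    by metis
  have "\<exists>E. D p \<subseteq> E \<and> E \<subseteq> part A p \<and> independent E \<and> part A p \<subseteq> span E" for p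
  proof -
    have "D p \<subseteq> part A p" using D(1)[of p] d_G[of _ "p - 1"] by auto
    show ?thesis
      by (rule maximal_independent_subset_extend[OF \<open>D p \<subseteq> part A p\<close> D(2)]) (intro exI conjI)
  qed
  then obtain E where E: "\<And>p. D p \<subseteq> E p" "\<And>p. E p \<subseteq> part A p" "\<And>p. independent (E p)"
    "\<And>p. part A p \<subseteq> span (E p)"
    by metis
  note DE = D(1,3) E
  have uniq: "p = q" if "v \<in> E p" "v \<in> E q" for v p q
    by (rule direct_sum_basis_degree_unique[where S = "part A", OF dir sub E(2,3) that])
  have indep: "independent (\<Union>p. E p)"
    by (rule independent_UN_direct_sum[where S = "part A", OF dir sub E(2,3)])
  define dg where "dg v = (THE p. v \<in> E p)" for v
  have dg: "dg v = p" if "v \<in> E p" for v p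
    unfolding dg_def using that uniq by blast

  obtain bar where bar: "Vector_Spaces.linear (scl A) (scl A) bar"
    "\<forall>v\<in>(\<Union>p. E p). bar v = scl A ((-1) powi dg v) v"
    using vs.linear_independent_extend[OF indep, of "\<lambda>v. scl A ((-1) powi dg v) v"] by blast
  obtain g where g: "Vector_Spaces.linear (scl A) (scl A) g"
    "\<forall>v\<in>(\<Union>p. E p). g v = (if v \<in> D (dg v) then SOME c. c \<in> part A (dg v - 1) \<and> d c = v else 0)"
    using vs.linear_independent_extend[OF indep,
      of "\<lambda>v. if v \<in> D (dg v) then SOME c. c \<in> part A (dg v - 1) \<and> d c = v else 0"] by blast
  have g_D: "g v \<in> part A (p - 1) \<and> d (g v) = v" if "v \<in> D p" for v p
  proof -
    have "v \<in> E p" using DE(3) that by blast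
    moreover have "\<exists>c. c \<in> part A (p - 1) \<and> d c = v" using DE(1)[of p] that by blast
    from someI_ex[OF this] have "(SOME c. c \<in> part A (p - 1) \<and> d c = v) \<in> part A (p - 1) \<and>
      d (SOME c. c \<in> part A (p - 1) \<and> d c = v) = v" .
    ultimately show ?thesis using g(2) that by (auto simp: dg)
  qed
  have g_E: "g v \<in> part A (p - 1)" if "v \<in> E p" for v p
    using g(2) g_D[of v p] that by (cases "v \<in> D p") (auto simp: dg subspace_0[OF sub])
  have bar_G: "bar x = scl A ((-1) powi p) x" if "x \<in> part A p" for x p
    by (rule vs.linear_eq_on_span[OF bar(1) vs.linear_compose_scale_right[OF module_hom_ident], of "E p"])
      (use bar(2) DE(6) that in \<open>auto simp: dg\<close>)
  have g_G: "g x \<in> part A (p - 1)" if "x \<in> part A p" for x p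
  proof -
    have "subspace {x. g x \<in> part A (p - 1)}"
      using sub[of "p - 1"] by (auto simp: subspace_def vs.linear_0[OF g(1)] vs.linear_add[OF g(1)]
          vs.linear_scale[OF g(1)])
    moreover have "x \<in> span (E p)" using that DE(6) by blast
    ultimately show ?thesis
      using span_minimal[of "E p" "{x. g x \<in> part A (p - 1)}"] g_E by blast
  qed
  have dgd: "d (g (d x)) = d x" if "x \<in> part A p" for x p
  proof (rule vs.linear_eq_on_span[where f = "\<lambda>y. d (g y)", OF _ module_hom_ident, of "D (p + 1)"])
    show "Vector_Spaces.linear (scl A) (scl A) (\<lambda>y. d (g y))"
      using Vector_Spaces.linear_compose[OF g(1) lin_d] by (simp add: comp_def)
    show "d x \<in> span (D (p + 1))" using DE(2)[of "p + 1"] that by auto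
  qed (use g_D in blast)

  \<comment> \<open>The map g already satisfies \<open>d g d = d\<close>.  The correction keeps this, since it is killed by d,
    and makes \<open>d h h d = d g g d - d g d g g d\<close> vanish.\<close>
  define h where "h x = g x - d (g (g x))" for x
  note lin_simps = vs.linear_diff[OF lin_d] vs.linear_diff[OF g(1)]
  have h_G: "h x \<in> part A (p - 1)" if "x \<in> part A p" for x p
    unfolding h_def using g_G[OF that] d_G[OF g_G[OF g_G[OF that]]]
    by (simp add: subspace_diff[OF sub])
  have dh: "d (h x) = d (g x)" if "x \<in> part A p" for x p
    using dd[OF g_G[OF g_G[OF that]]] by (simp add: h_def lin_simps)
  have "contracted_dga (scl A) (part A) d bar h m"
  proof (rule contracted_dga.intro[OF vector_space_axioms], rule contracted_dga_axioms.intro)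
    show "Vector_Spaces.linear (scl A) (scl A) h"
      unfolding h_def[abs_def]
      by (intro vs.linear_compose_sub g(1))
        (use Vector_Spaces.linear_compose[OF Vector_Spaces.linear_compose[OF g(1) g(1)] lin_d]
          in \<open>simp add: comp_def\<close>)
    show "d (m x y) = m (d x) y + m (bar x) (d y)" if "x \<in> part A p" "y \<in> part A q" for x y p q
    proof -
      have "d (m x y) = diff A (prd A x y)"
        using d_eq[OF m_G[OF that]] m_eq[OF that] by simp
      moreover have "m (d x) y = prd A (diff A x) y"
        using m_eq[OF d_G[OF that(1)] that(2)] d_eq[OF that(1)] by simp
      moreover have "m x (d y) = prd A x (diff A y)"
        using m_eq[OF that(1) d_G[OF that(2)]] d_eq[OF that(2)] by simp
      ultimately show ?thesis
        using rules(4)[OF that that(2)] vs.linear_scale[OF lin_m(1)] by (simp add: bar_G[OF that(1)])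
    qed
    show "m (m x y) z = m x (m y z)" if "x \<in> part A p" "y \<in> part A q" "z \<in> part A r" for x y z p q r
      using rules(5)[OF that] m_eq[OF m_G[OF that(1,2)] that(3)] m_eq[OF that(1) m_G[OF that(2,3)]]
        m_eq[OF that(1,2)] m_eq[OF that(2,3)] by simp
    show "d (h (d x)) = d x" if "x \<in> part A p" for x p
      using dh[OF d_G[OF that]] dgd[OF that] by simp
    show "d (h (h (d x))) = 0" if "x \<in> part A p" for x p
    proof -
      have "d (h (h (d x))) = d (g (g (d x))) - d (g (d (g (g (d x)))))"
        using dh[OF h_G[OF d_G[OF that]]] by (simp add: h_def lin_simps)
      then show ?thesis using dgd[OF g_G[OF g_G[OF d_G[OF that]]]] by simp
    qed
  qed (fact sub lin_d bar(1) lin_m d_G h_G m_G bar_G dd)+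
  then show ?thesis
    by (rule that) (simp_all add: d_def m_def pr_id)
qed


section \<open>Formality\<close>

text \<open>
  Only the differential (s = 1) and the product (s = 2) contribute for a dg-algebra.
\<close>

lemma insert_sum_dg:
  fixes A :: "('k::field, 'a::ab_group_add, 'm) ainf_scheme"
    and B :: "('k, 'b::ab_group_add, 'l) ainf_scheme"
  assumes "vector_space (scl B)" "length xs = n"
    and high: "\<And>r s t. r + s + t = n \<Longrightarrow> 3 \<le> s \<Longrightarrow>
      g (r + 1 + t) (take r xs @ [mlt A s (take s (drop r xs))] @ drop (r + s) xs) = 0"
  shows "insert_sum A B g ds xs =
    (\<Sum>r<n. scl B ((-1) ^ (n - 1) * (-1) powi sum_list (take r ds))
       (g n (take r xs @ diff A (xs ! r) # drop (Suc r) xs)))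
    + (\<Sum>r<n - 1. scl B ((-1) ^ r)
       (g (n - 1) (take r xs @ prd A (xs ! r) (xs ! Suc r) # drop (Suc (Suc r)) xs)))"
proof -
  interpret vector_space "scl B" by fact
  define tm where "tm = (\<lambda>(r, s, t). scl B ((-1) ^ (r + s * t) * (-1) powi ((2 - int s) * sum_list (take r ds)))
          (g (r + 1 + t) (take r xs @ [mlt A s (take s (drop r xs))] @ drop (r + s) xs)))"
  define S1 where "S1 = (\<lambda>r. (r, 1::nat, n - 1 - r)) ` {..<n}"
  define S2 where "S2 = (\<lambda>r. (r, 2::nat, n - 2 - r)) ` {..<n - 1}"
  have "insert_sum A B g ds xs = sum tm {(r, s, t). r + s + t = n \<and> 1 \<le> s}"
    by (simp add: insert_sum_def tm_def assms)
  also have "\<dots> = sum tm (S1 \<union> S2)"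
  proof (rule sum.mono_neutral_right)
    show "finite {(r, s, t). r + s + t = n \<and> 1 \<le> s}" by (rule finite_insert_index)
    show "S1 \<union> S2 \<subseteq> {(r, s, t). r + s + t = n \<and> 1 \<le> s}"
      by (auto simp: S1_def S2_def)
    show "\<forall>x\<in>{(r, s, t). r + s + t = n \<and> 1 \<le> s} - (S1 \<union> S2). tm x = 0"
    proof
      fix x assume x: "x \<in> {(r, s, t). r + s + t = n \<and> 1 \<le> s} - (S1 \<union> S2)"
      obtain r s t where [simp]: "x = (r, s, t)" by (cases x)
      have "s \<noteq> 1" "s \<noteq> 2"
        using x by (auto simp: S1_def S2_def image_iff)
      then have "3 \<le> s" using x by auto
      then show "tm x = 0" using high[of r s t] x by (simp add: tm_def)
    qed
  qed
  also have "\<dots> = sum tm S1 + sum tm S2"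
    by (rule sum.union_disjoint) (auto simp: S1_def S2_def)
  also have "sum tm S1 = (\<Sum>r<n. scl B ((-1) ^ (n - 1) * (-1) powi sum_list (take r ds))
       (g n (take r xs @ diff A (xs ! r) # drop (Suc r) xs)))"
  proof -
    have "take 1 (drop r xs) = [xs ! r]" if "r < n" for r
      using that assms(2) by (simp add: Cons_nth_drop_Suc[symmetric])
    moreover have "Suc (r + (n - 1 - r)) = n" if "r < n" for r using that by auto
    ultimately show ?thesis
      unfolding S1_def
      by (subst sum.reindex) (auto simp: inj_on_def tm_def diff_def intro!: sum.cong)
  qed
  also have "sum tm S2 = (\<Sum>r<n - 1. scl B ((-1) ^ r)
       (g (n - 1) (take r xs @ prd A (xs ! r) (xs ! Suc r) # drop (Suc (Suc r)) xs)))"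
  proof -
    have "take 2 (drop r xs) = [xs ! r, xs ! Suc r]" if "r < n - 1" for r
      using that assms(2) by (simp add: Cons_nth_drop_Suc[symmetric] numeral_2_eq_2)
    moreover have "Suc (r + (n - 2 - r)) = n - 1" if "r < n - 1" for r using that by auto
    ultimately show ?thesis
      unfolding S2_def
      by (subst sum.reindex)
        (auto simp: inj_on_def tm_def prd_def power_add power_mult intro!: sum.cong)
  qed
  finally show ?thesis .
qed

text \<open>
  A contraction of a given dg-algebra A, by maps that agree with the operations of A on the graded
  space.
\<close>

locale dga_contraction =
  contracted_dga "scl A" "part A" d bar h m
  for A :: "('k::field, 'a::ab_group_add) ainf" and d bar h m +
  assumes dg: "dg_algebra A"
    and diff_eq: "x \<in> total_space A \<Longrightarrow> diff A x = d x"
    and prd_eq: "x \<in> total_space A \<Longrightarrow> y \<in> total_space A \<Longrightarrow> prd A x y = m x y"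
begin

lemma total_space_eq: "total_space A = T"
  by (simp add: total_space_def T_def)

lemmas diff_d = diff_eq[unfolded total_space_eq] and prd_m = prd_eq[unfolded total_space_eq]

lemma coh_class_image: "coh_class A v = (\<lambda>y. v + d y) ` T"
  unfolding coh_class_def total_space_eq Setcompr_eq_image
  by (intro image_cong refl) (simp add: diff_d)

lemma coh_class_eq_iff: "coh_class A x = coh_class A y \<longleftrightarrow> x - y \<in> d ` T"
proof -
  have cc: "w \<in> coh_class A v \<longleftrightarrow> w - v \<in> d ` T" for v w
    by (auto simp: coh_class_image image_iff algebra_simps)
  have sub: "subspace (d ` T)" by (rule vs.linear_subspace_image[OF lin_d T_subspace])
  show ?thesis
  proof
    assume "coh_class A x = coh_class A y"
    then show "x - y \<in> d ` T"
      using cc[of x x] cc[of x y] subspace_0[OF sub] by simp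
  next
    assume xy: "x - y \<in> d ` T"
    have "w - x \<in> d ` T \<longleftrightarrow> w - y \<in> d ` T" for w
      using subspace_add[OF sub _ xy, of "w - x"] subspace_diff[OF sub _ xy, of "w - y"] by auto
    then show "coh_class A x = coh_class A y" using cc by blast
  qed
qed

lemma P_T: "P ` T = span (\<Union>p. P ` part A p)"
  unfolding T_def using vs.linear_span_image[OF lin_P, of "\<Union>p. part A p"] by (simp add: image_UN)

text \<open>
  The target is the image of P with zero operations.  Its cohomology is itself, and P induces the
  isomorphism: it takes the same value exactly on cohomologous cocycles, because \<open>1 = P + d h\<close> on
  cocycles, and it is a projection.
\<close>

lemma formal_if_mor_rel:
  assumes mor_rel: "\<And>n. 1 \<le> n \<Longrightarrow> mor_rel n"
  shows "formal A"
proof -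
  define B :: "('k, 'a) ainf" where "B = \<lparr>scl = scl A, part = (\<lambda>p. P ` part A p), mlt = (\<lambda>n xs. 0)\<rparr>"
  have B [simp]: "scl B = scl A" "part B = (\<lambda>p. P ` part A p)" "mlt B = (\<lambda>n xs. 0)"
    by (simp_all add: B_def)
  have tot_B: "total_space B = P ` T"
    by (simp add: total_space_def P_T)
  have "graded_space A"
    using dg by (simp add: dg_algebra_def A_inf_algebra_def)
  then have dir: "\<forall>p\<in>I. x p = 0" if "finite I" "\<forall>p\<in>I. x p \<in> part A p" "(\<Sum>p\<in>I. x p) = 0" for I x
    using that unfolding graded_space_def by blast
  have "graded_space B"
    unfolding graded_space_def
  proof (intro conjI allI impI, goal_cases)
    case (3 I x)
    have "\<forall>p\<in>I. x p \<in> part A p" using 3 P_G by auto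
    then show ?case using 3 dir by blast
  qed (simp_all add: vector_space_axioms subspace_PG)
  moreover have "multilinear_deg B B n q (\<lambda>xs. 0)" for n q
    by (simp add: multilinear_deg_def subspace_0[OF subspace_PG])
  ultimately have "dg_algebra B"
    by (simp add: dg_algebra_def A_inf_algebra_def insert_sum_def)
  moreover have diff_B: "diff B x = 0" for x
    by (simp add: diff_def)
  moreover have "A_inf_morphism A B mor"
    unfolding A_inf_morphism_def
  proof (intro conjI allI impI)
    fix n :: nat assume n: "1 \<le> n"
    show "multilinear_deg A B n (1 - int n) (mor n)"
      unfolding multilinear_deg_def
    proof (intro conjI allI impI, goal_cases)
      case (1 xs i x y)
      then show ?case
        using vs.linear_add[OF mlin_lin[OF mlin_mor]] by (simp add: upd_conv_take_nth_drop)
    next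
      case (2 xs i c x)
      then show ?case
        using vs.linear_scale[OF mlin_lin[OF mlin_mor]] by (simp add: upd_conv_take_nth_drop)
    next
      case (3 ds xs)
      then show ?case
        using hdeg_mor[OF n] by (auto simp: hdeg_def homog_def)
    qed
  next
    fix ds :: "int list" and xs :: "'a list"
    assume "1 \<le> length xs \<and> homog A ds xs"
    then have len: "1 \<le> length xs" and pre_h: "list_all2 (\<lambda>p x. x \<in> part A p) ds xs"
      by (auto simp: homog_def)
    define n where "n = length xs"
    have xsT: "xs ! r \<in> T" if "r < n" for r
      using pre_h that by (auto simp: list_all2_conv_all_nth n_def intro: T_G)
    then have set_T: "set xs \<subseteq> T" by (auto simp: in_set_conv_nth n_def)
    have "insert_sum A B mor ds xs =
      (\<Sum>r<n. scl B ((-1) ^ (n - 1) * (-1) powi sum_list (take r ds))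
         (mor n (take r xs @ diff A (xs ! r) # drop (Suc r) xs)))
      + (\<Sum>r<n - 1. scl B ((-1) ^ r)
         (mor (n - 1) (take r xs @ prd A (xs ! r) (xs ! Suc r) # drop (Suc (Suc r)) xs)))"
    proof (rule insert_sum_dg)
      fix r s t assume rst: "r + s + t = n" "3 \<le> s"
      have "mlt A s (take s (drop r xs)) = 0"
        using dg rst set_T set_take_subset[of s "drop r xs"] set_drop_subset[of r xs]
        by (auto simp: dg_algebra_def total_space_eq n_def subset_iff)
      then show "mor (r + 1 + t) (take r xs @ [mlt A s (take s (drop r xs))] @ drop (r + s) xs) = 0"
        using vs.linear_0[OF mlin_lin[OF mlin_mor]] by simp
    qed (simp_all add: n_def vector_space_axioms)
    also have "(\<Sum>r<n. scl B ((-1) ^ (n - 1) * (-1) powi sum_list (take r ds))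
         (mor n (take r xs @ diff A (xs ! r) # drop (Suc r) xs))) = scl A ((-1) ^ (n - 1)) (pre_d (mor n) xs)"
      using xsT by (simp add: pre_d_closed_form[OF mlin_mor pre_h] scale_sum_right diff_d n_def)
    also have "(\<Sum>r<n - 1. scl B ((-1) ^ r)
         (mor (n - 1) (take r xs @ prd A (xs ! r) (xs ! Suc r) # drop (Suc (Suc r)) xs)))
       = pre_m (mor (n - 1)) xs"
      using xsT by (simp add: pre_m_closed_form prd_m n_def)
    also have "pre_d (mor n) xs = scl A ((-1) ^ n) (pre_m (mor (n - 1)) xs)"
      using mor_rel[of n] len set_T by (simp add: mor_rel_def n_def)
    also have "scl A ((-1) ^ (n - 1)) (scl A ((-1) ^ n) (pre_m (mor (n - 1)) xs)) = - pre_m (mor (n - 1)) xs"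
      using len by (cases n) (simp_all add: n_def)
    finally show "insert_sum A B mor ds xs = (\<Sum>k = 1..length xs. \<Sum>is\<in>compositions k (length xs).
           scl B ((-1) powi (u_exp is) * (-1) powi (koszul_exp is ds))
             (mlt B k (map (\<lambda>j. mor (is ! j) (block is xs j)) [0..<k])))"
      by simp
  qed
  moreover have "bij_betw (coh_map B (\<lambda>x. mor 1 [x])) (cohomology A) (cohomology B)"
  proof -
    have T: "T \<noteq> {}" using T_closed(4) by blast
    have cc_B: "coh_class B x = {x}" for x
      using T by (simp add: coh_class_def diff_B tot_B)
    have coc: "cocycles A = {x \<in> T. d x = 0}"
      by (auto simp: cocycles_def total_space_eq diff_d)
    have coh_B: "cohomology B = (\<lambda>x. {P x}) ` T"
      by (auto simp: cohomology_def cocycles_def diff_B tot_B cc_B)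
    have map: "coh_map B (\<lambda>x. mor 1 [x]) (coh_class A z) = {P z}" for z
    proof -
      have "coh_map B (\<lambda>x. mor 1 [x]) (coh_class A z) = (\<Union>y\<in>T. {P (z + d y)})"
        by (simp add: coh_map_def cc_B coh_class_image)
      also have "\<dots> = (\<Union>y\<in>T. {P z})" by (intro SUP_cong refl) simp
      finally show ?thesis using T by simp
    qed
    show ?thesis
      unfolding bij_betw_def
    proof
      show "inj_on (coh_map B (\<lambda>x. mor 1 [x])) (cohomology A)"
      proof (rule inj_onI)
        fix X Y assume "X \<in> cohomology A" "Y \<in> cohomology A"
        then obtain x y where x: "x \<in> T" "d x = 0" "X = coh_class A x"
          and y: "y \<in> T" "d y = 0" "Y = coh_class A y"
          by (auto simp: cohomology_def coc)
        assume "coh_map B (\<lambda>x. mor 1 [x]) X = coh_map B (\<lambda>x. mor 1 [x]) Y"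
        then have "P x = P y" using x y by (simp only: map) simp
        then have "x - y = d (h (x - y))"
          using x y by (simp add: P_def algebra_simps)
        moreover have "h (x - y) \<in> T" using x y by simp
        ultimately have "x - y \<in> d ` T" by (rule image_eqI)
        then show "X = Y" using x y coh_class_eq_iff by simp
      qed
      show "coh_map B (\<lambda>x. mor 1 [x]) ` cohomology A = cohomology B"
      proof -
        have "coh_map B (\<lambda>x. mor 1 [x]) ` cohomology A = (\<lambda>z. {P z}) ` cocycles A"
          unfolding cohomology_def image_image by (simp only: map)
        also have "\<dots> = (\<lambda>x. {P x}) ` T"
        proof
          show "(\<lambda>x. {P x}) ` T \<subseteq> (\<lambda>z. {P z}) ` cocycles A"
          proof
            fix X assume "X \<in> (\<lambda>x. {P x}) ` T"
            then obtain x where "x \<in> T" "X = {P x}" by auto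
            then show "X \<in> (\<lambda>z. {P z}) ` cocycles A"
              by (intro image_eqI[of _ _ "P x"]) (auto simp: coc P_P)
          qed
        qed (auto simp: coc)
        finally show ?thesis by (simp add: coh_B)
      qed
    qed
  qed
  ultimately show ?thesis
    unfolding formal_def A_inf_quasi_isomorphism_def by blast
qed

lemma massey_sum_eq_massey_cochain:
  assumes "\<And>k. i < k \<Longrightarrow> k < j \<Longrightarrow> a i k \<in> part A (e i k) \<and> a k j \<in> part A (e k j)"
  shows "massey_sum A e a i j = massey_cochain a i j"
  unfolding massey_sum_def massey_cochain_def
proof (rule sum.cong)
  fix k assume "k \<in> {i<..<j}"
  then have a: "a i k \<in> part A (e i k)" "a k j \<in> part A (e k j)" using assms by auto
  show "prd A (scl A ((-1) powi e i k) (a i k)) (a k j) = m (bar (a i k)) (a k j)"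
    using a by (simp add: bar_hom prd_m T_G)
qed simp

lemma defining_system_iff_massey_sys:
  "defining_system A (map (\<lambda>k. coh_class A (z k)) [0..<n]) e a \<longleftrightarrow> massey_sys z n e a"
proof -
  have 1: "(\<forall>i\<in>{1..n}. coh_class A (a (i - 1) i) = map (\<lambda>k. coh_class A (z k)) [0..<n] ! (i - 1))
    \<longleftrightarrow> (\<forall>k<n. a k (Suc k) - z k \<in> d ` T)" (is "?l \<longleftrightarrow> ?r")
  proof -
    have "{1..n} = Suc ` {..<n}" by (simp add: image_Suc_lessThan)
    then show ?thesis by (auto simp: coh_class_eq_iff)
  qed
  have 2: "(\<forall>i j. i < j \<and> j \<le> n \<and> (i, j) \<noteq> (0, n) \<longrightarrow>
        a i j \<in> part A (e i j) \<and> diff A (a i j) = massey_sum A e a i j)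
    \<longleftrightarrow> (\<forall>i j. i < j \<and> j \<le> n \<and> (i, j) \<noteq> (0, n) \<longrightarrow> a i j \<in> part A (e i j) \<and> d (a i j) = massey_cochain a i j)"
    (is "?l \<longleftrightarrow> ?r")
  proof -
    have "diff A (a i j) = d (a i j) \<and> massey_sum A e a i j = massey_cochain a i j"
      if "\<forall>i j. i < j \<and> j \<le> n \<and> (i, j) \<noteq> (0, n) \<longrightarrow> a i j \<in> part A (e i j)"
        "i < j" "j \<le> n" "(i, j) \<noteq> (0, n)" for i j
    proof
      show "diff A (a i j) = d (a i j)" using that by (intro diff_d T_G) blast
      show "massey_sum A e a i j = massey_cochain a i j" by (rule massey_sum_eq_massey_cochain) (use that in auto)
    qed
    note eq = this
    show ?thesis
    proof
      assume l: ?l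
      show ?r
      proof (intro allI impI)
        fix i j assume ij: "i < j \<and> j \<le> n \<and> (i, j) \<noteq> (0, n)"
        have "diff A (a i j) = d (a i j) \<and> massey_sum A e a i j = massey_cochain a i j"
          by (rule eq) (use l ij in blast)+
        moreover have "a i j \<in> part A (e i j) \<and> diff A (a i j) = massey_sum A e a i j"
          using l ij by blast
        ultimately show "a i j \<in> part A (e i j) \<and> d (a i j) = massey_cochain a i j" by metis
      qed
    next
      assume r: ?r
      show ?l
      proof (intro allI impI)
        fix i j assume ij: "i < j \<and> j \<le> n \<and> (i, j) \<noteq> (0, n)"
        then show "a i j \<in> part A (e i j) \<and> diff A (a i j) = massey_sum A e a i j"
          using r eq[of i j] by simp
      qed
    qed
  qed
  show ?thesis
    unfolding defining_system_def massey_sys_def using 1 2 by simp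
qed

lemma massey_sys_if_vanishing:
  assumes prod: "\<forall>X\<in>cohomology A. \<forall>Y\<in>cohomology A. coh_prd A X Y = coh_class A 0"
    and massey: "\<forall>n\<ge>3. \<forall>xs. length xs = n \<and> (\<forall>X\<in>set xs. \<exists>p. X \<in> cohomology_deg A p) \<and>
           massey_defined A xs \<longrightarrow> massey_vanishes A xs"
    and n: "2 \<le> n" and z: "\<And>k. k < n \<Longrightarrow> z k \<in> part A (p k) \<and> d (z k) = 0"
    and system: "massey_sys z n e a"
  shows "\<exists>e a. massey_sys z n e a \<and> massey_cochain a 0 n \<in> d ` T"
proof (cases "n = 2")
  case True
  have massey_cochain: "massey_cochain a k (Suc k) = 0" for k :: nat
  proof -
    have "{k<..<Suc k} = {}" by auto
    then show ?thesis by (simp add: massey_cochain_def)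
  qed
  have "a k (Suc k) \<in> T \<and> d (a k (Suc k)) = 0" if "k < 2" for k
  proof -
    have "k < Suc k \<and> Suc k \<le> n \<and> (k, Suc k) \<noteq> (0, n) \<longrightarrow>
      a k (Suc k) \<in> part A (e k (Suc k)) \<and> d (a k (Suc k)) = massey_cochain a k (Suc k)"
      using system unfolding massey_sys_def by blast
    then show ?thesis using that True massey_cochain T_G by auto
  qed
  from this[of 0] this[of 1] have a: "a 0 1 \<in> T" "d (a 0 1) = 0" "a 1 2 \<in> T" "d (a 1 2) = 0"
    by (simp_all add: numeral_2_eq_2)
  have coh: "coh_class A x \<in> cohomology A" if "x \<in> T" "d x = 0" for x
    using that by (auto simp: cohomology_def cocycles_def total_space_eq diff_d)
  have mem: "x \<in> coh_class A x" if "x \<in> T" for x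
  proof -
    have "x + diff A 0 \<in> coh_class A x"
      unfolding coh_class_def total_space_eq using T_closed(4) by blast
    then show ?thesis by (simp add: diff_d)
  qed
  have "prd A (bar (a 0 1)) (a 1 2) \<in> coh_prd A (coh_class A (bar (a 0 1))) (coh_class A (a 1 2))"
    unfolding coh_prd_def using a
    by (intro UN_I[of "bar (a 0 1)"] UN_I[of "a 1 2"] mem) (simp_all add: prd_m)
  also have "\<dots> = coh_class A 0"
    using prod coh a d_bar by auto
  finally have "m (bar (a 0 1)) (a 1 2) \<in> d ` T"
    using a by (auto simp: coh_class_def total_space_eq diff_d prd_m)
  moreover have "{0<..<2::nat} = {1}" by auto
  ultimately have "massey_cochain a 0 n \<in> d ` T"
    by (simp add: massey_cochain_def True)
  then show ?thesis using system by blast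
next
  case False
  let ?xs = "map (\<lambda>k. coh_class A (z k)) [0..<n]"
  have "\<exists>p. coh_class A (z k) \<in> cohomology_deg A p" if "k < n" for k
    using z[OF that] by (intro exI[of _ "p k"])
      (auto simp: cohomology_deg_def cocycles_def total_space_eq diff_d T_G)
  moreover have "massey_defined A ?xs"
    unfolding massey_defined_def using system defining_system_iff_massey_sys by blast
  moreover have "3 \<le> n" using n False by simp
  ultimately have "massey_vanishes A ?xs"
    using massey[THEN spec, of n] by simp
  then obtain e' a' where a': "massey_sys z n e' a'"
    and cl: "coh_class A 0 = coh_class A (massey_sum A e' a' 0 n)"
    by (auto simp: massey_vanishes_def massey_product_def defining_system_iff_massey_sys)
  have "massey_sum A e' a' 0 n = massey_cochain a' 0 n"
    by (rule massey_sum_eq_massey_cochain) (use a' in \<open>auto simp: massey_sys_def\<close>)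
  then have "massey_cochain a' 0 n \<in> d ` T"
    using cl[symmetric] coh_class_eq_iff[of "massey_cochain a' 0 n" 0] by simp
  then show ?thesis using a' by blast
qed

end

theorem theorem5:
  fixes A :: "('k::field_char_0, 'a::ab_group_add) ainf"
  assumes "dg_algebra A"
    and "\<forall>X\<in>cohomology A. \<forall>Y\<in>cohomology A. coh_prd A X Y = coh_class A 0"
    and "\<forall>n\<ge>3. \<forall>xs. length xs = n \<and> (\<forall>X\<in>set xs. \<exists>p. X \<in> cohomology_deg A p) \<and>
           massey_defined A xs \<longrightarrow> massey_vanishes A xs"
  shows "formal A"
proof -
  obtain d bar h m where c: "contracted_dga (scl A) (part A) d bar h m"
    and d: "\<And>x. x \<in> total_space A \<Longrightarrow> d x = diff A x"
    and m: "\<And>x y. x \<in> total_space A \<Longrightarrow> y \<in> total_space A \<Longrightarrow> m x y = prd A x y"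
    by (rule contraction_exists[OF assms(1)]) (rule that, assumption, blast+)
  interpret dga_contraction A d bar h m
    using c assms(1) d m by (intro dga_contraction.intro dga_contraction_axioms.intro) auto
  interpret massey_trivial_dga "scl A" "part A" d bar h m
    by unfold_locales (rule massey_sys_if_vanishing[OF assms(2,3)])
  show ?thesis by (rule formal_if_mor_rel[OF mor_rel_all])
qed

end
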